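(* Let $\mathbb{A}$ be a medial generic isospectral algebra of dimension $n$ over an algebraically closed subfield of $\mathbb{C}$ and let $c$ be a nonzero idempotent. Then the set $\mathrm{Idm}(\mathbb{A})$ of nonzero idempotents with the operation $x\boxplus y:=L_c^{-1}(xy)$ is a cyclic group of order $2^n-1$.
   Context: All algebras commutative, possibly nonassociative, finite-dimensional. Medial: $(xy)(zw)=(xz)(yw)$ identically. $L_c:x\mapsto cx$. Isospectral: all nonzero idempotents have the same spectrum (multiset of eigenvalues of $L_c$). Generic: the complexification has exactly $2^n$ idempotents (including $0$). *)

theory Defs
  imports "HOL-Analysis.Analysis" "HOL-Algebra.Algebra"
          "HOL-Computational_Algebra.Fundamental_Theorem_Algebra"
begin

definition is_subfield_C :: "complex set \<Rightarrow> bool" where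
  "is_subfield_C K \<longleftrightarrow> 0 \<in> K \<and> 1 \<in> K \<and>
     (\<forall>x\<in>K. \<forall>y\<in>K. x + y \<in> K \<and> x - y \<in> K \<and> x * y \<in> K) \<and>
     (\<forall>x\<in>K. x \<noteq> 0 \<longrightarrow> inverse x \<in> K)"

definition alg_closed_C :: "complex set \<Rightarrow> bool" where
  "alg_closed_C K \<longleftrightarrow> (\<forall>p :: complex poly. (\<forall>i. Polynomial.coeff p i \<in> K) \<and> Polynomial.degree p > 0
      \<longrightarrow> (\<exists>z\<in>K. poly p z = 0))"

text \<open>An n-dimensional commutative algebra over K is given (w.r.t. a basis indexed by the
finite type 'n) by structure constants gam i j k \<in> K, symmetric in i j.
Its elements are the vectors with coordinates in K; the complexification is all of complex^'n,
with the same structure constants.\<close>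
definition amul :: "('n::finite \<Rightarrow> 'n \<Rightarrow> 'n \<Rightarrow> complex) \<Rightarrow> complex^'n \<Rightarrow> complex^'n \<Rightarrow> complex^'n" where
  "amul gam x y = (\<chi> k. \<Sum>i\<in>UNIV. \<Sum>j\<in>UNIV. x$i * y$j * gam i j k)"

definition carrierK :: "complex set \<Rightarrow> (complex^'n::finite) set" where
  "carrierK K = {x. \<forall>i. x$i \<in> K}"

definition commutative_sc :: "('n::finite \<Rightarrow> 'n \<Rightarrow> 'n \<Rightarrow> complex) \<Rightarrow> bool" where
  "commutative_sc gam \<longleftrightarrow> (\<forall>i j k. gam i j k = gam j i k)"

definition medial :: "complex set \<Rightarrow> ('n::finite \<Rightarrow> 'n \<Rightarrow> 'n \<Rightarrow> complex) \<Rightarrow> bool" where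
  "medial K gam \<longleftrightarrow> (\<forall>x\<in>carrierK K. \<forall>y\<in>carrierK K. \<forall>z\<in>carrierK K. \<forall>w\<in>carrierK K.
      amul gam (amul gam x y) (amul gam z w) = amul gam (amul gam x z) (amul gam y w))"

definition Idm :: "complex set \<Rightarrow> ('n::finite \<Rightarrow> 'n \<Rightarrow> 'n \<Rightarrow> complex) \<Rightarrow> (complex^'n) set" where
  "Idm K gam = {x \<in> carrierK K. x \<noteq> 0 \<and> amul gam x x = x}"

definition generic :: "('n::finite \<Rightarrow> 'n \<Rightarrow> 'n \<Rightarrow> complex) \<Rightarrow> bool" where
  "generic gam \<longleftrightarrow> finite {x :: complex^'n. amul gam x x = x}
      \<and> card {x :: complex^'n. amul gam x x = x} = 2 ^ CARD('n)"

definition Lmat :: "('n::finite \<Rightarrow> 'n \<Rightarrow> 'n \<Rightarrow> complex) \<Rightarrow> complex^'n \<Rightarrow> complex^'n^'n" where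
  "Lmat gam c = (\<chi> k j. \<Sum>i\<in>UNIV. c$i * gam i j k)"

definition charpoly_L :: "('n::finite \<Rightarrow> 'n \<Rightarrow> 'n \<Rightarrow> complex) \<Rightarrow> complex^'n \<Rightarrow> complex poly" where
  "charpoly_L gam c = det (\<chi> k j. (if k = j then [:0, 1:] else 0) - [: Lmat gam c $ k $ j :])"

definition spectrum_L :: "('n::finite \<Rightarrow> 'n \<Rightarrow> 'n \<Rightarrow> complex) \<Rightarrow> complex^'n \<Rightarrow> complex multiset" where
  "spectrum_L gam c = proots (charpoly_L gam c)"

definition isospectral :: "complex set \<Rightarrow> ('n::finite \<Rightarrow> 'n \<Rightarrow> 'n \<Rightarrow> complex) \<Rightarrow> bool" where
  "isospectral K gam \<longleftrightarrow> (\<forall>x\<in>Idm K gam. \<forall>y\<in>Idm K gam. spectrum_L gam x = spectrum_L gam y)"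

definition boxplus :: "complex set \<Rightarrow> ('n::finite \<Rightarrow> 'n \<Rightarrow> 'n \<Rightarrow> complex) \<Rightarrow> complex^'n
     \<Rightarrow> complex^'n \<Rightarrow> complex^'n \<Rightarrow> complex^'n" where
  "boxplus K gam c x y = inv_into (carrierK K) (amul gam c) (amul gam x y)"

definition Idm_group :: "complex set \<Rightarrow> ('n::finite \<Rightarrow> 'n \<Rightarrow> 'n \<Rightarrow> complex) \<Rightarrow> complex^'n
     \<Rightarrow> complex^'n \<Rightarrow> (complex^'n) monoid" where
  "Idm_group K gam c e = \<lparr>carrier = Idm K gam, mult = boxplus K gam c, one = e\<rparr>"

end

theory Submission
  imports Defs
begin

text \<open>
  Mediality makes \<open>L\<^sub>c\<close> an endomorphism for every idempotent \<open>c\<close>, so products of idempotents are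
  idempotents. By the Nullstellensatz the finitely many complex idempotents have coordinates in \<open>K\<close>,
  so isospectrality applies to all of them; it forbids nonzero idempotents with \<open>cd = 0\<close>. Since
  \<open>ox = o\<close> makes \<open>x - o\<close> an idempotent with \<open>o(x - o) = 0\<close>, it also forces \<open>x = o\<close>; from this
  absorption law and mediality, \<open>L\<^sub>c\<close> has finite order on the nonzero idempotents, which therefore
  form an abelian group \<open>G\<close> under \<open>L\<^sub>c\<^sup>-\<^sup>1(xy)\<close>. A common eigenvector \<open>v\<close> of \<open>G\<close> in its linear span
  gives a character \<open>\<kappa>\<close>; it is injective because the mean of its kernel is an idempotent absorbing
  the kernel. Hence \<open>G\<close> is cyclic, of order \<open>2\<^sup>n - 1\<close>. The vectors \<open>L\<^sub>c\<^sup>i v\<close> for \<open>i < n\<close> are eigenvectors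
  of a generator with the distinct eigenvalues \<open>\<zeta>\<close> to the power \<open>2\<^sup>i\<close>, so \<open>G\<close> spans the algebra and
  \<open>L\<^sub>c\<close> has finite order on all of it.
\<close>

subsection \<open>Rationality of finite solution sets\<close>

definition subring_C :: "complex set \<Rightarrow> bool" where
  "subring_C R \<longleftrightarrow> 0 \<in> R \<and> 1 \<in> R \<and>
     (\<forall>x\<in>R. \<forall>y\<in>R. x + y \<in> R \<and> x - y \<in> R \<and> x * y \<in> R)"

definition polys_over :: "complex set \<Rightarrow> complex poly set" where
  "polys_over R = {p. \<forall>i. Polynomial.coeff p i \<in> R}"

lemma subring_C_sum: "subring_C R \<Longrightarrow> (\<And>i. i \<in> A \<Longrightarrow> f i \<in> R) \<Longrightarrow> sum f A \<in> R"
  by (induction A rule: infinite_finite_induct) (auto simp: subring_C_def)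

lemma subring_C_prod: "subring_C R \<Longrightarrow> (\<And>i. i \<in> A \<Longrightarrow> f i \<in> R) \<Longrightarrow> prod f A \<in> R"
  by (induction A rule: infinite_finite_induct) (auto simp: subring_C_def)

lemma subring_C_power: "subring_C R \<Longrightarrow> x \<in> R \<Longrightarrow> x ^ k \<in> R"
  by (induction k) (auto simp: subring_C_def)

lemma polys_over_zero: "subring_C R \<Longrightarrow> 0 \<in> polys_over R"
  by (simp add: polys_over_def subring_C_def)

lemma polys_over_pCons: "a \<in> R \<Longrightarrow> p \<in> polys_over R \<Longrightarrow> pCons a p \<in> polys_over R"
  by (auto simp: polys_over_def coeff_pCons split: nat.split)

lemma polys_over_add: "subring_C R \<Longrightarrow> p \<in> polys_over R \<Longrightarrow> q \<in> polys_over R \<Longrightarrow> p + q \<in> polys_over R"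
  by (auto simp: polys_over_def subring_C_def)

lemma polys_over_diff: "subring_C R \<Longrightarrow> p \<in> polys_over R \<Longrightarrow> q \<in> polys_over R \<Longrightarrow> p - q \<in> polys_over R"
  by (auto simp: polys_over_def subring_C_def)

lemma polys_over_mult: "subring_C R \<Longrightarrow> p \<in> polys_over R \<Longrightarrow> q \<in> polys_over R \<Longrightarrow> p * q \<in> polys_over R"
  by (auto simp: polys_over_def coeff_mult subring_C_def[of R] intro!: subring_C_sum)

lemma polys_over_smult: "subring_C R \<Longrightarrow> a \<in> R \<Longrightarrow> p \<in> polys_over R \<Longrightarrow> Polynomial.smult a p \<in> polys_over R"
  by (auto simp: polys_over_def subring_C_def)

lemma polys_over_monom: "subring_C R \<Longrightarrow> a \<in> R \<Longrightarrow> Polynomial.monom a k \<in> polys_over R"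
  by (auto simp: polys_over_def subring_C_def)

lemma polys_over_const: "subring_C R \<Longrightarrow> a \<in> R \<Longrightarrow> [:a:] \<in> polys_over R"
  by (simp add: polys_over_pCons polys_over_zero)

text \<open>Elements of \<open>R\<close> need not be invertible in \<open>R\<close>, so
  \<open>g\<close> is scaled by the leading coefficient of \<open>q\<close> before a multiple of
  \<open>q\<close> cancels its leading term; the degree then drops.\<close>

lemma pseudo_division_over:
  assumes R: "subring_C R" and q: "q \<in> polys_over R" "q \<noteq> 0" and "g \<in> polys_over R"
  shows "\<exists>k. \<exists>h\<in>polys_over R. \<exists>r\<in>polys_over R.
    Polynomial.smult (Polynomial.lead_coeff q ^ k) g = q * h + r \<and> (r = 0 \<or> Polynomial.degree r < Polynomial.degree q)"
  using \<open>g \<in> polys_over R\<close>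
proof (induction "Polynomial.degree g" arbitrary: g rule: less_induct)
  case less
  show ?case
  proof (cases "g = 0 \<or> Polynomial.degree g < Polynomial.degree q")
    case True
    then show ?thesis
      using less.prems polys_over_zero[OF R] by (intro exI[of _ 0] bexI[of _ 0] bexI[of _ g]) auto
  next
    case False
    define a where "a = Polynomial.lead_coeff q"
    define m where "m = Polynomial.monom (Polynomial.lead_coeff g) (Polynomial.degree g - Polynomial.degree q)"
    define g' where "g' = Polynomial.smult a g - q * m"
    have aR: "a \<in> R" and a0: "a \<noteq> 0" using q by (auto simp: a_def polys_over_def)
    have mR: "m \<in> polys_over R"
      unfolding m_def using less.prems by (intro polys_over_monom[OF R]) (auto simp: polys_over_def)
    have g'R: "g' \<in> polys_over R"
      unfolding g'_def by (intro polys_over_diff polys_over_smult polys_over_mult R aR less.prems q mR)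
    show ?thesis
    proof (cases "g' = 0")
      case True
      then show ?thesis
        using mR polys_over_zero[OF R]
        by (intro exI[of _ 1] bexI[of _ m] bexI[of _ 0]) (auto simp: g'_def a_def)
    next
      case g'0: False
      have d: "Polynomial.degree (q * m) = Polynomial.degree g"
        using False q by (subst degree_mult_eq) (auto simp: m_def Polynomial.degree_monom_eq)
      have "Polynomial.degree g' < Polynomial.degree g"
      proof -
        have "Polynomial.degree g' \<le> Polynomial.degree g"
          unfolding g'_def using d by (intro degree_diff_le) auto
        moreover have "Polynomial.coeff g' (Polynomial.degree g) = 0"
        proof -
          have "Polynomial.coeff (q * m) (Polynomial.degree g) = Polynomial.lead_coeff (q * m)" by (simp add: d)
          also have "\<dots> = a * Polynomial.lead_coeff g"
            using False by (simp add: lead_coeff_mult a_def m_def Polynomial.degree_monom_eq)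
          finally show ?thesis by (simp add: g'_def)
        qed
        ultimately show ?thesis using g'0
          by (metis le_neq_implies_less leading_coeff_0_iff)
      qed
      from less.hyps[OF this g'R] obtain k h r where
        *: "h \<in> polys_over R" "r \<in> polys_over R" "Polynomial.smult (a ^ k) g' = q * h + r"
          "r = 0 \<or> Polynomial.degree r < Polynomial.degree q" unfolding a_def by blast
      have "Polynomial.smult (a ^ Suc k) g = Polynomial.smult (a ^ k) g' + Polynomial.smult (a ^ k) (q * m)"
        by (simp add: g'_def smult_diff_right mult.commute)
      also have "\<dots> = q * (h + Polynomial.smult (a ^ k) m) + r" using *(3) by (simp add: algebra_simps)
      finally have "Polynomial.smult (a ^ Suc k) g = q * (h + Polynomial.smult (a ^ k) m) + r" .
      moreover have "h + Polynomial.smult (a ^ k) m \<in> polys_over R"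
        by (intro polys_over_add polys_over_smult subring_C_power R * mR aR)
      ultimately show ?thesis using * unfolding a_def by blast
    qed
  qed
qed

text \<open>Among the polynomials over \<open>R\<close> whose value at \<open>x\<close> is a nonzero multiple of \<open>poly p x\<close>, one of least
  degree is constant: otherwise dividing \<open>q\<close> by it would factor the minimal polynomial \<open>q\<close>.\<close>
lemma algebraic_divides_base:
  assumes R: "subring_C R" and q: "q \<in> polys_over R" "q \<noteq> 0" "poly q x = 0"
    and q_min: "\<And>g. g \<in> polys_over R \<Longrightarrow> g \<noteq> 0 \<Longrightarrow> poly g x = 0 \<Longrightarrow> Polynomial.degree q \<le> Polynomial.degree g"
    and p: "p \<in> polys_over R" "poly p x \<noteq> 0"
  shows "\<exists>p'\<in>polys_over R. poly p x * poly p' x \<in> R - {0}"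
proof -
  define P where "P g \<longleftrightarrow> g \<in> polys_over R \<and> poly g x \<noteq> 0 \<and> (\<exists>p'\<in>polys_over R. poly g x = poly p x * poly p' x)" for g
  have "P p" unfolding P_def using p R
    by (auto intro!: bexI[of _ "[:1:]"] polys_over_const simp: subring_C_def)
  then obtain g where g: "P g" and g_min: "\<And>g'. P g' \<Longrightarrow> Polynomial.degree g \<le> Polynomial.degree g'"
    using ex_has_least_nat[of P p Polynomial.degree] by blast
  obtain p' where p': "p' \<in> polys_over R" "poly g x = poly p x * poly p' x" using g P_def by blast
  have gR: "g \<in> polys_over R" "poly g x \<noteq> 0" using g P_def by auto
  \<comment> \<open>The remainder of a scaled \<open>g\<close> modulo \<open>q\<close> has the same
    value at \<open>x\<close> up to a nonzero factor from \<open>R\<close>, so it still satisfies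
    \<open>P\<close>.\<close>
  have "Polynomial.degree g < Polynomial.degree q"
  proof -
    obtain k h r where h: "h \<in> polys_over R" "r \<in> polys_over R" "Polynomial.smult (Polynomial.lead_coeff q ^ k) g = q * h + r"
      "r = 0 \<or> Polynomial.degree r < Polynomial.degree q"
      using pseudo_division_over[OF R q(1,2) gR(1)] by blast
    have "poly (Polynomial.smult (Polynomial.lead_coeff q ^ k) g) x = poly (q * h + r) x" using h by simp
    hence e: "poly r x = Polynomial.lead_coeff q ^ k * poly g x" by (simp add: q)
    have "poly (Polynomial.smult (Polynomial.lead_coeff q ^ k) p') x = Polynomial.lead_coeff q ^ k * poly p' x" by simp
    moreover have "Polynomial.smult (Polynomial.lead_coeff q ^ k) p' \<in> polys_over R"
      using q(1) by (intro polys_over_smult subring_C_power R p') (auto simp: polys_over_def)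
    ultimately have "\<exists>p''\<in>polys_over R. poly r x = poly p x * poly p'' x"
      by (intro bexI[of _ "Polynomial.smult (Polynomial.lead_coeff q ^ k) p'"]) (auto simp: e p')
    then have "P r" unfolding P_def using h(2) gR q e by auto
    then have "r \<noteq> 0" "Polynomial.degree g \<le> Polynomial.degree r" using g_min unfolding P_def by auto
    with h(4) show ?thesis by linarith
  qed
  have "Polynomial.degree g = 0"
  proof (rule ccontr)
    assume dg: "Polynomial.degree g \<noteq> 0"
    then have g0: "g \<noteq> 0" by auto
    obtain k h r where h: "h \<in> polys_over R" "r \<in> polys_over R" "Polynomial.smult (Polynomial.lead_coeff g ^ k) q = g * h + r"
      "r = 0 \<or> Polynomial.degree r < Polynomial.degree g"
      using pseudo_division_over[OF R gR(1) g0 q(1)] by blast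
    have "poly (Polynomial.smult (Polynomial.lead_coeff g ^ k) q) x = poly (g * h + r) x" using h by simp
    then have e: "poly r x = poly p x * poly ([:0:] - p' * h) x" by (simp add: q p' eq_neg_iff_add_eq_0 add.commute mult.assoc)
    have hp: "[:0:] - p' * h \<in> polys_over R"
      using R by (intro polys_over_diff polys_over_mult polys_over_const R h p') (auto simp: subring_C_def)
    \<comment> \<open>A remainder not vanishing at \<open>x\<close> would satisfy \<open>P\<close>
      with smaller degree than \<open>g\<close>.\<close>
    have r0: "poly r x = 0"
    proof (rule ccontr)
      assume "poly r x \<noteq> 0"
      with e hp h have "P r" unfolding P_def by blast
      with g_min[OF this] h(4) show False using \<open>poly r x \<noteq> 0\<close> by auto
    qed
    have "r = 0"
      using q_min[OF h(2) _ r0] h(4) \<open>Polynomial.degree g < Polynomial.degree q\<close> by linarith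
    with h(3) have qe: "Polynomial.smult (Polynomial.lead_coeff g ^ k) q = g * h" by simp
    have nz: "Polynomial.smult (Polynomial.lead_coeff g ^ k) q \<noteq> 0" using g0 q by simp
    have "h \<noteq> 0" using qe nz by auto
    \<comment> \<open>Since \<open>g\<close> does not vanish at \<open>x\<close>, the cofactor
      \<open>h\<close> must, against the minimality of \<open>q\<close>.\<close>
    have "Polynomial.degree q = Polynomial.degree g + Polynomial.degree h"
      using arg_cong[OF qe, of Polynomial.degree] g0 \<open>h \<noteq> 0\<close> by (simp add: degree_mult_eq)
    moreover have "poly h x = 0"
      using arg_cong[OF qe, of "\<lambda>p. poly p x"] gR q by simp
    ultimately show False using q_min[OF h(1) \<open>h \<noteq> 0\<close>] dg by linarith
  qed
  then obtain b where "g = [:b:]" by (metis degree_eq_zeroE)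
  with gR p' show ?thesis by (auto simp: polys_over_def coeff_pCons split: nat.splits)
qed

section \<open>Homomorphisms of \<open>K\<close>-algebras into \<open>K\<close>, and the
  Nullstellensatz\<close>

definition specialization :: "complex set \<Rightarrow> complex set \<Rightarrow> (complex \<Rightarrow> complex) \<Rightarrow> bool" where
  "specialization K R \<sigma> \<longleftrightarrow> (\<forall>x\<in>R. \<sigma> x \<in> K) \<and> (\<forall>k\<in>K. \<sigma> k = k) \<and>
     (\<forall>x\<in>R. \<forall>y\<in>R. \<sigma> (x + y) = \<sigma> x + \<sigma> y \<and> \<sigma> (x * y) = \<sigma> x * \<sigma> y)"

lemma specialization_sum:
  assumes "subring_C R" "0 \<in> K" "specialization K R \<sigma>" "\<And>i. i \<in> A \<Longrightarrow> f i \<in> R"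
  shows "\<sigma> (sum f A) = (\<Sum>i\<in>A. \<sigma> (f i))"
  using assms(4)
proof (induction A rule: infinite_finite_induct)
  case (insert a A)
  then have "f a \<in> R" "sum f A \<in> R" using subring_C_sum[OF assms(1), of A f] by simp_all
  with insert assms show ?case by (auto simp: specialization_def)
qed (use assms in \<open>auto simp: specialization_def\<close>)

lemma map_poly_specialization:
  assumes R: "subring_C R" and K: "0 \<in> K" and s: "specialization K R \<sigma>"
    and p: "p \<in> polys_over R" and q: "q \<in> polys_over R"
  shows "map_poly \<sigma> (p + q) = map_poly \<sigma> p + map_poly \<sigma> q"
    and "map_poly \<sigma> (p * q) = map_poly \<sigma> p * map_poly \<sigma> q"
    and "map_poly \<sigma> p \<in> polys_over K"
proof -
  have s0: "\<sigma> 0 = 0" using s K by (auto simp: specialization_def)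
  have pq: "Polynomial.coeff p i \<in> R" "Polynomial.coeff q i \<in> R" for i using p q by (auto simp: polys_over_def)
  show "map_poly \<sigma> (p + q) = map_poly \<sigma> p + map_poly \<sigma> q"
    using s pq by (intro poly_eqI) (auto simp: coeff_map_poly s0 specialization_def)
  show "map_poly \<sigma> p \<in> polys_over K"
    using s pq by (auto simp: coeff_map_poly s0 specialization_def polys_over_def)
  show "map_poly \<sigma> (p * q) = map_poly \<sigma> p * map_poly \<sigma> q"
  proof (intro poly_eqI)
    fix n
    have pqR: "Polynomial.coeff p i * Polynomial.coeff q j \<in> R" for i j
      using pq R by (auto simp: subring_C_def)
    show "Polynomial.coeff (map_poly \<sigma> (p * q)) n = Polynomial.coeff (map_poly \<sigma> p * map_poly \<sigma> q) n"
      using s pq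
      by (simp add: coeff_map_poly s0 coeff_mult specialization_sum[OF R K s pqR]) (auto simp: specialization_def)
  qed
qed

text \<open>The assumption \<open>van\<close> makes the prescription \<open>poly p x \<mapsto> poly (map_poly \<sigma> p) t\<close> well defined.\<close>
lemma specialization_adjoin:
  assumes R: "subring_C R" and K: "subring_C K" "K \<subseteq> R" and s: "specialization K R \<sigma>" and t: "t \<in> K"
    and van: "\<And>g. g \<in> polys_over R \<Longrightarrow> poly g x = 0 \<Longrightarrow> poly (map_poly \<sigma> g) t = 0"
  defines "R' \<equiv> {poly p x |p. p \<in> polys_over R}"
  obtains \<tau> where "specialization K R' \<tau>" "\<And>p. p \<in> polys_over R \<Longrightarrow> \<tau> (poly p x) = poly (map_poly \<sigma> p) t"
proof -
  define \<tau> where "\<tau> y = poly (map_poly \<sigma> (SOME p. p \<in> polys_over R \<and> poly p x = y)) t" for y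
  have K0: "0 \<in> K" using K by (auto simp: subring_C_def)
  note mp = map_poly_specialization[OF R K0 s]
  have \<tau>: "\<tau> (poly p x) = poly (map_poly \<sigma> p) t" if p: "p \<in> polys_over R" for p
  proof -
    define p' where "p' = (SOME q. q \<in> polys_over R \<and> poly q x = poly p x)"
    have p': "p' \<in> polys_over R" "poly p' x = poly p x"
      unfolding p'_def using someI[of "\<lambda>q. q \<in> polys_over R \<and> poly q x = poly p x" p] p by auto
    have d: "p' - p \<in> polys_over R" using p p' by (intro polys_over_diff R)
    have "poly (map_poly \<sigma> p') t = poly (map_poly \<sigma> (p' - p)) t + poly (map_poly \<sigma> p) t"
      using mp(1)[OF d p] by simp
    also have "poly (map_poly \<sigma> (p' - p)) t = 0" using p' by (intro van d) simp
    finally show ?thesis by (simp add: \<tau>_def p'_def)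
  qed
  have "specialization K R' \<tau>"
    unfolding specialization_def
  proof (intro conjI ballI)
    fix y assume "y \<in> R'"
    then obtain p where p: "p \<in> polys_over R" "y = poly p x" by (auto simp: R'_def)
    have "poly r t \<in> K" if "r \<in> polys_over K" for r
      using that t unfolding poly_altdef
      by (intro subring_C_sum[OF K(1)]) (auto simp: polys_over_def subring_C_power[OF K(1)] K(1)[unfolded subring_C_def])
    then show "\<tau> y \<in> K" using p \<tau> mp(3) by auto
  next
    fix k assume k: "k \<in> K"
    then have "\<sigma> k = k" using s by (auto simp: specialization_def)
    moreover have "[:k:] \<in> polys_over R" using k K(2) by (intro polys_over_const R) auto
    ultimately show "\<tau> k = k" using \<tau>[of "[:k:]"] s K0 by (simp add: map_poly_pCons specialization_def)
  next
    fix y z assume "y \<in> R'" "z \<in> R'"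
    then obtain p q where "p \<in> polys_over R" "y = poly p x" "q \<in> polys_over R" "z = poly q x"
      by (auto simp: R'_def)
    then show "\<tau> (y + z) = \<tau> y + \<tau> z" "\<tau> (y * z) = \<tau> y * \<tau> z"
      using \<tau>[of "p + q"] \<tau>[of "p * q"] \<tau>[of p] \<tau>[of q] mp[of p q]
        polys_over_add[OF R, of p q] polys_over_mult[OF R, of p q] by simp_all
  qed
  with \<tau> that show ?thesis by blast
qed

text \<open>The conclusion of the Nullstellensatz, phrased as an invariant that survives adjoining
  one element at a time: every nonzero element of \<open>R\<close> is nonzero at some
  \<open>K\<close>-valued point.\<close>

definition specializable :: "complex set \<Rightarrow> complex set \<Rightarrow> bool" where
  "specializable K R \<longleftrightarrow> subring_C R \<and> K \<subseteq> R \<and> (\<forall>f\<in>R - {0}. \<exists>\<sigma>. specialization K R \<sigma> \<and> \<sigma> f \<noteq> 0)"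

lemma subfield_subring_C: "is_subfield_C K \<Longrightarrow> subring_C K"
  by (auto simp: is_subfield_C_def subring_C_def)

lemma infinite_subring_C: "subring_C K \<Longrightarrow> infinite K"
proof -
  assume K: "subring_C K"
  have "of_nat k \<in> K" for k using K by (induction k) (auto simp: subring_C_def)
  then have "range (of_nat :: nat \<Rightarrow> complex) \<subseteq> K" by auto
  moreover have "infinite (range (of_nat :: nat \<Rightarrow> complex))"
    by (intro range_inj_infinite) (auto simp: inj_on_def)
  ultimately show ?thesis using finite_subset by blast
qed

text \<open>For \<open>x\<close> transcendental over \<open>R\<close>, almost every \<open>t\<close>
  in \<open>K\<close> is a possible image of \<open>x\<close>. For \<open>x\<close> algebraic, a
  root of the specialized minimal polynomial is taken, and \<open>f\<close> stays nonzero because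
  some multiple of it is a nonzero element of \<open>R\<close> that is kept nonzero.\<close>

lemma specializable_adjoin:
  assumes K: "subring_C K" "alg_closed_C K" and R: "specializable K R"
  obtains R' where "specializable K R'" "R \<subseteq> R'" "x \<in> R'"
proof -
  define R' where "R' = {poly p x |p. p \<in> polys_over R}"
  have sR: "subring_C R" and KR: "K \<subseteq> R" using R by (auto simp: specializable_def)
  have K0: "0 \<in> K" using K by (auto simp: subring_C_def)
  have inR': "poly p x \<in> R'" if "p \<in> polys_over R" for p using that by (auto simp: R'_def)
  have RR': "R \<subseteq> R'"
    using inR'[OF polys_over_const[OF sR]] by auto
  have "x \<in> R'"
    using inR'[of "[:0,1:]"] sR polys_over_zero[OF sR] by (simp add: polys_over_pCons subring_C_def)
  have "subring_C R'"
    unfolding subring_C_def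
  proof (intro conjI ballI)
    show "0 \<in> R'" "1 \<in> R'" using RR' sR by (auto simp: subring_C_def)
    fix y z assume "y \<in> R'" "z \<in> R'"
    then obtain p q where "p \<in> polys_over R" "y = poly p x" "q \<in> polys_over R" "z = poly q x"
      by (auto simp: R'_def)
    then show "y + z \<in> R'" "y - z \<in> R'" "y * z \<in> R'"
      using inR'[of "p + q"] inR'[of "p * q"] inR'[of "p - q"]
        polys_over_add[OF sR, of p q] polys_over_mult[OF sR, of p q] polys_over_diff[OF sR, of p q] by simp_all
  qed
  have "\<exists>\<tau>. specialization K R' \<tau> \<and> \<tau> f \<noteq> 0" if "f \<in> R' - {0}" for f
  proof -
    from that obtain p where p: "p \<in> polys_over R" "f = poly p x" "f \<noteq> 0" by (auto simp: R'_def)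
    show ?thesis
    proof (cases "\<exists>q\<in>polys_over R. q \<noteq> 0 \<and> poly q x = 0")
      case False
      have "p \<noteq> 0" using p by auto
      \<comment> \<open>Keeping the leading coefficient nonzero keeps the specialized polynomial
        nonzero, so some \<open>t\<close> in the infinite set \<open>K\<close> is not among its
        roots.\<close>
      then have "Polynomial.lead_coeff p \<in> R - {0}" using p by (auto simp: polys_over_def)
      then obtain \<sigma> where s: "specialization K R \<sigma>" "\<sigma> (Polynomial.lead_coeff p) \<noteq> 0"
        using R unfolding specializable_def by blast
      have s0: "\<sigma> 0 = 0" using s K0 by (auto simp: specialization_def)
      have "map_poly \<sigma> p \<noteq> 0" using s(2) coeff_map_poly[of \<sigma>, OF s0, of p] by (metis coeff_0)
      then have "finite {t. poly (map_poly \<sigma> p) t = 0}" by (rule poly_roots_finite)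
      then obtain t where t: "t \<in> K" "poly (map_poly \<sigma> p) t \<noteq> 0"
        using infinite_subring_C[OF K(1)] finite_subset[of K "{t. poly (map_poly \<sigma> p) t = 0}"] by blast
      have van: "poly (map_poly \<sigma> g) t = 0" if "g \<in> polys_over R" "poly g x = 0" for g
        using False that by auto
      obtain \<tau> where "specialization K R' \<tau>" "\<And>p. p \<in> polys_over R \<Longrightarrow> \<tau> (poly p x) = poly (map_poly \<sigma> p) t"
        using specialization_adjoin[OF sR K(1) KR s(1) t(1) van] unfolding R'_def by blast
      with t p show ?thesis by auto
    next
      case True
      then obtain q0 where "q0 \<in> polys_over R \<and> q0 \<noteq> 0 \<and> poly q0 x = 0" by blast
      then obtain q where q: "q \<in> polys_over R \<and> q \<noteq> 0 \<and> poly q x = 0"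
        and q_min: "\<And>g. g \<in> polys_over R \<and> g \<noteq> 0 \<and> poly g x = 0 \<Longrightarrow> Polynomial.degree q \<le> Polynomial.degree g"
        using ex_has_least_nat[of "\<lambda>q. q \<in> polys_over R \<and> q \<noteq> 0 \<and> poly q x = 0" q0 Polynomial.degree] by blast
      obtain p' where p': "p' \<in> polys_over R" "poly p x * poly p' x \<in> R - {0}"
        using algebraic_divides_base[OF sR, of q x p] q q_min p by auto
      define a where "a = Polynomial.lead_coeff q"
      have a: "a \<in> R - {0}" using q by (auto simp: a_def polys_over_def)
      \<comment> \<open>A single \<sigma> must preserve both factors: the leading coefficient of
        \<open>q\<close> and the multiple of \<open>f\<close> that lies in \<open>R\<close>.\<close>
      have "a * (poly p x * poly p' x) \<in> R - {0}" using a p' sR by (auto simp: subring_C_def)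
      then obtain \<sigma> where s: "specialization K R \<sigma>" "\<sigma> (a * (poly p x * poly p' x)) \<noteq> 0"
        using R unfolding specializable_def by blast
      note mp = map_poly_specialization[OF sR K0 s(1)]
      have s0: "\<sigma> 0 = 0" using s K0 by (auto simp: specialization_def)
      have sab: "\<sigma> a \<noteq> 0" "\<sigma> (poly p x * poly p' x) \<noteq> 0" using s a p' by (auto simp: specialization_def)
      have "Polynomial.degree q \<noteq> 0" 
      proof
        assume "Polynomial.degree q = 0"
        then obtain b where "q = [:b:]" by (rule degree_eq_zeroE)
        with q show False by simp
      qed
      \<comment> \<open>As \<open>\<sigma> a \<noteq> 0\<close>, no degree is lost, so the
        specialized \<open>q\<close> has a root in \<open>K\<close>.\<close>
      moreover have "Polynomial.degree q \<le> Polynomial.degree (map_poly \<sigma> q)"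
        using sab(1) by (intro Polynomial.le_degree) (simp add: a_def coeff_map_poly s0)
      ultimately have "Polynomial.degree (map_poly \<sigma> q) > 0" by linarith
      moreover have "map_poly \<sigma> q \<in> polys_over K" using mp(3) q by blast
      ultimately obtain t where t: "t \<in> K" "poly (map_poly \<sigma> q) t = 0"
        using K(2) unfolding alg_closed_C_def polys_over_def by blast
      \<comment> \<open>By minimality of \<open>q\<close>, pseudo-division gives
        \<open>a ^ k\<close> times \<open>g\<close> as a multiple of \<open>q\<close>; after
        specialization the factor \<open>\<sigma> a ^ k\<close> can be cancelled at the root
        \<open>t\<close>.\<close>
      have van: "poly (map_poly \<sigma> g) t = 0" if g: "g \<in> polys_over R" "poly g x = 0" for g
      proof -
        obtain k h r where h: "h \<in> polys_over R" "r \<in> polys_over R" "Polynomial.smult (a ^ k) g = q * h + r"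
          "r = 0 \<or> Polynomial.degree r < Polynomial.degree q"
          using pseudo_division_over[OF sR _ _ g(1)] q unfolding a_def by blast
        have "poly (Polynomial.smult (a ^ k) g) x = poly (q * h + r) x" using h by simp
        then have "poly r x = 0" using g q by simp
        then have "r = 0" using h q_min[of r] by linarith
        have ak: "a ^ k \<in> R" using a by (intro subring_C_power sR) auto
        have "\<sigma> (a ^ k) = \<sigma> a ^ k"
        proof (induction k)
          case 0
          then show ?case using s K(1) by (auto simp: specialization_def subring_C_def)
        next
          case (Suc k)
          then show ?case using s a subring_C_power[OF sR, of a k] by (auto simp: specialization_def)
        qed
        then have m: "map_poly \<sigma> [:a ^ k:] = [:\<sigma> a ^ k:]" by (simp add: map_poly_pCons s0)
        have "[:a ^ k:] * g = q * h" using h(3) \<open>r = 0\<close> by simp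
        then have "map_poly \<sigma> [:a ^ k:] * map_poly \<sigma> g = map_poly \<sigma> q * map_poly \<sigma> h"
          using mp(2)[of "[:a^k:]" g] mp(2)[of q h] polys_over_const[OF sR ak] g h q by simp
        then have "poly ([:\<sigma> a ^ k:] * map_poly \<sigma> g) t = poly (map_poly \<sigma> q * map_poly \<sigma> h) t" unfolding m by simp
        then show ?thesis using t sab by simp
      qed
      obtain \<tau> where \<tau>: "specialization K R' \<tau>" "\<And>p. p \<in> polys_over R \<Longrightarrow> \<tau> (poly p x) = poly (map_poly \<sigma> p) t"
        using specialization_adjoin[OF sR K(1) KR s(1) t(1) van] unfolding R'_def by blast
      have "\<tau> b = \<sigma> b" if "b \<in> R" for b
        using \<tau>(2)[OF polys_over_const[OF sR that]] s0 by (cases "b = 0") (auto simp: map_poly_pCons)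
      then have "\<tau> (poly p x * poly p' x) \<noteq> 0" using sab p' by auto
      moreover have "\<tau> (poly p x * poly p' x) = \<tau> f * \<tau> (poly p' x)"
        using \<tau>(1) inR' p p' by (auto simp: specialization_def)
      ultimately show ?thesis using \<tau>(1) by auto
    qed
  qed
  then have "specializable K R'" using \<open>subring_C R'\<close> KR RR' unfolding specializable_def by blast
  with that RR' \<open>x \<in> R'\<close> show ?thesis by blast
qed

lemma specializable_finite_superset:
  assumes K: "subring_C K" "alg_closed_C K" and "finite A"
  obtains R where "specializable K R" "A \<subseteq> R"
proof -
  have "\<exists>R. specializable K R \<and> A \<subseteq> R"
    using \<open>finite A\<close>
  proof induction
    case empty
    have "specializable K K"
    proof -
      have "specialization K K (\<lambda>x. x)" by (simp add: specialization_def)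
      with K(1) show ?thesis unfolding specializable_def by blast
    qed
    then show ?case by blast
  next
    case (insert x A)
    then obtain R where R: "specializable K R" "A \<subseteq> R" by blast
    obtain R' where "specializable K R'" "R \<subseteq> R'" "x \<in> R'"
      using specializable_adjoin[OF K R(1)] .
    with R(2) show ?case by blast
  qed
  with that show ?thesis by blast
qed

text \<open>If coordinate \<open>l\<close> of \<open>x\<close> were outside \<open>K\<close>, the
  product \<open>f\<close> of its differences from the \<open>l\<close>-th coordinates of all
  \<open>K\<close>-rational idempotents would be nonzero. A specialization that keeps
  \<open>f\<close> nonzero sends \<open>x\<close> to a \<open>K\<close>-rational idempotent
  \<open>y\<close>, yet kills the factor of \<open>f\<close> belonging to \<open>y\<close>.\<close>

lemma finite_idempotents_rational:
  assumes K: "is_subfield_C K" "alg_closed_C K" and gam: "\<forall>i j k. gam i j k \<in> K"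
    and fin: "finite {x :: complex^'n::finite. amul gam x x = x}" and x: "amul gam x x = x"
  shows "x \<in> carrierK K"
proof (rule ccontr)
  assume "x \<notin> carrierK K"
  then obtain l where l: "x $ l \<notin> K" by (auto simp: carrierK_def)
  have sK: "subring_C K" using K(1) by (rule subfield_subring_C)
  have K0: "0 \<in> K" using sK by (auto simp: subring_C_def)
  obtain R where R: "specializable K R" "range (($) x) \<subseteq> R"
    using specializable_finite_superset[OF sK K(2), of "range (($) x)"] by auto
  have xR: "x $ i \<in> R" for i using R by auto
  have sR: "subring_C R" and KR: "K \<subseteq> R" using R by (auto simp: specializable_def)
  define S where "S = {y \<in> carrierK K. amul gam y y = y}"
  have "finite S" unfolding S_def by (rule finite_subset[OF _ fin]) auto
  define f where "f = (\<Prod>s\<in>S. x $ l - s $ l)"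
  have SK: "s $ i \<in> K" if "s \<in> S" for s i using that by (auto simp: S_def carrierK_def)
  have "f \<noteq> 0" using l SK \<open>finite S\<close> by (fastforce simp: f_def)
  moreover have "x $ l - s $ l \<in> R" if "s \<in> S" for s
    using xR SK[OF that] KR sR unfolding subring_C_def by blast
  then have "f \<in> R" unfolding f_def by (intro subring_C_prod[OF sR])
  ultimately obtain \<sigma> where s: "specialization K R \<sigma>" "\<sigma> f \<noteq> 0"
    using R unfolding specializable_def by blast
  define y where "y = (\<chi> i. \<sigma> (x $ i))"
  have gR: "gam i j k \<in> R" for i j k using gam KR by blast
  have mR: "a * b \<in> R" if "a \<in> R" "b \<in> R" for a b using sR that by (auto simp: subring_C_def)
  have sm: "\<sigma> (a * b) = \<sigma> a * \<sigma> b" if "a \<in> R" "b \<in> R" for a b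
    using s that by (auto simp: specialization_def)
  have "amul gam y y = y"
  proof (intro vec_eq_iff[THEN iffD2] allI)
    fix k
    have "y $ k = \<sigma> (amul gam x x $ k)" by (simp add: x y_def)
    also have "\<dots> = \<sigma> (\<Sum>i\<in>UNIV. \<Sum>j\<in>UNIV. x $ i * x $ j * gam i j k)" by (simp add: amul_def)
    also have "\<dots> = (\<Sum>i\<in>UNIV. \<Sum>j\<in>UNIV. \<sigma> (x $ i * x $ j * gam i j k))"
      by (subst specialization_sum[OF sR K0 s(1)], (intro subring_C_sum[OF sR] mR xR gR)[1])
        (intro sum.cong refl specialization_sum[OF sR K0 s(1)] mR xR gR)
    also have "\<dots> = amul gam y y $ k"
      using s(1) gam by (simp add: amul_def y_def sm mR xR gR) (auto simp: specialization_def)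
    finally show "amul gam y y $ k = y $ k" ..
  qed
  moreover have "y \<in> carrierK K" using s xR by (auto simp: carrierK_def y_def specialization_def)
  ultimately have "y \<in> S" by (simp add: S_def)
  define z where "z = x $ l - y $ l"
  have zR: "z \<in> R" "y $ l \<in> K" using xR SK[OF \<open>y \<in> S\<close>] KR sR unfolding subring_C_def z_def by blast+
  have "\<sigma> z = 0"
  proof -
    have "\<sigma> (z + y $ l) = \<sigma> z + \<sigma> (y $ l)" using s zR KR by (auto simp: specialization_def)
    moreover have "\<sigma> (z + y $ l) = y $ l" by (simp add: z_def y_def)
    moreover have "\<sigma> (y $ l) = y $ l" using s zR by (auto simp: specialization_def)
    ultimately show ?thesis by simp
  qed
  have "f = z * (\<Prod>s\<in>S - {y}. x $ l - s $ l)"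
    unfolding f_def z_def using \<open>finite S\<close> \<open>y \<in> S\<close> by (rule prod.remove)
  moreover have "(\<Prod>s\<in>S - {y}. x $ l - s $ l) \<in> R"
    using \<open>\<And>s. s \<in> S \<Longrightarrow> x $ l - s $ l \<in> R\<close> by (intro subring_C_prod[OF sR]) auto
  ultimately have "\<sigma> f = 0" using sm zR \<open>\<sigma> z = 0\<close> by simp
  with s show False by simp
qed

subsection \<open>Eigenvectors\<close>

abbreviation clinear :: "(complex^'n::finite \<Rightarrow> complex^'n) \<Rightarrow> bool" where
  "clinear \<equiv> Vector_Spaces.linear (*s) (*s)"

lemma clinearI:
  "(\<And>x y. f (x + y) = f x + f y) \<Longrightarrow> (\<And>a x. f (a *s x) = a *s f x) \<Longrightarrow> clinear f"
  by (simp add: Vector_Spaces.linear_iff vec.vector_space_axioms)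

lemma clinear_funpow: "clinear f \<Longrightarrow> clinear (f ^^ k)"
  by (induction k) (auto simp: Vector_Spaces.linear_iff)

lemma clinear_compose: "clinear f \<Longrightarrow> clinear g \<Longrightarrow> clinear (\<lambda>x. f (g x))"
  by (auto simp: Vector_Spaces.linear_iff)

lemma clinear_rules:
  assumes "clinear f"
  shows "f (x + y) = f x + f y" "f (x - y) = f x - f y" "f (a *s x) = a *s f x" "f 0 = 0"
    "f (sum g A) = (\<Sum>i\<in>A. f (g i))"
  using assms vec.linear_add vec.linear_diff vec.linear_scale vec.linear_0 vec.linear_sum by auto

text \<open>Write p = (X - \<zeta>) q. Either q(T) w is nonzero and is an eigenvector for \<zeta>,
  or \<open>q\<close> annihilates \<open>w\<close> and has smaller degree. Summing up to a bound
  \<open>k\<close> rather than to the degree lets the induction run on \<open>k\<close>.\<close>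

lemma eigenvector_from_annihilator:
  fixes T :: "complex^'n::finite \<Rightarrow> complex^'n"
  assumes T: "clinear T" and W: "vec.subspace W" "\<And>x. x \<in> W \<Longrightarrow> T x \<in> W" and w: "w \<in> W" "w \<noteq> 0"
    and p: "p \<noteq> 0" "Polynomial.degree p \<le> k" "(\<Sum>i\<le>k. Polynomial.coeff p i *s (T ^^ i) w) = 0"
  shows "\<exists>\<zeta>. \<exists>v\<in>W. v \<noteq> 0 \<and> T v = \<zeta> *s v"
  using p
proof (induction k arbitrary: p)
  case 0
  then show ?case using w by (auto elim!: degree_eq_zeroE)
next
  case (Suc k)
  show ?case
  proof (cases "Polynomial.degree p \<le> k")
    case True
    then have "Polynomial.coeff p (Suc k) = 0" by (intro coeff_eq_0) auto
    with Suc True show ?thesis by auto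
  next
    case False
    then have "Polynomial.degree p > 0" by auto
    then obtain \<zeta> where "poly p \<zeta> = 0"
      using fundamental_theorem_of_algebra[of p] constant_degree[of p] by auto
    then obtain q where q: "p = [:-\<zeta>, 1:] * q" unfolding poly_eq_0_iff_dvd by (elim dvdE)
    have q0: "q \<noteq> 0" using Suc.prems q by auto
    have "Polynomial.degree p = Suc (Polynomial.degree q)" unfolding q using q0 by (subst degree_mult_eq) auto
    then have dq: "Polynomial.degree q \<le> k" using Suc.prems by auto
    define e where "e = (\<Sum>i\<le>k. Polynomial.coeff q i *s (T ^^ i) w)"
    have pe: "p = pCons 0 q - Polynomial.smult \<zeta> q" unfolding q by simp
    have "(\<Sum>i\<le>Suc k. Polynomial.coeff (pCons 0 q) i *s (T ^^ i) w) = T e"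
      unfolding e_def sum.atMost_Suc_shift by (simp add: clinear_rules[OF T] del: sum.atMost_Suc)
    moreover have "Polynomial.coeff q (Suc k) = 0" using dq by (intro coeff_eq_0) auto
    then have "(\<Sum>i\<le>Suc k. Polynomial.coeff (Polynomial.smult \<zeta> q) i *s (T ^^ i) w) = \<zeta> *s e"
      unfolding e_def by (simp add: vec.scale_sum_right)
    ultimately have "T e - \<zeta> *s e = (\<Sum>i\<le>Suc k. Polynomial.coeff p i *s (T ^^ i) w)"
      unfolding pe coeff_diff vec.scale_left_diff_distrib sum_subtractf by simp
    then have Te: "T e = \<zeta> *s e" using Suc.prems by simp
    have "(T ^^ i) w \<in> W" for i using w W by (induction i) auto
    then have "e \<in> W" unfolding e_def using W by (intro vec.subspace_sum vec.subspace_scale) auto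
    show ?thesis
    proof (cases "e = 0")
      case True
      then show ?thesis using Suc.IH[OF q0 dq] by (simp add: e_def)
    qed (use Te \<open>e \<in> W\<close> in blast)
  qed
qed

text \<open>The annihilating polynomial of \<open>w\<close> is X^N - 1.\<close>

lemma eigenvector_of_finite_order:
  fixes T :: "complex^'n::finite \<Rightarrow> complex^'n"
  assumes T: "clinear T" and W: "vec.subspace W" "\<And>x. x \<in> W \<Longrightarrow> T x \<in> W" and w: "w \<in> W" "w \<noteq> 0"
    and N: "N > 0" "(T ^^ N) w = w"
  obtains \<zeta> v where "v \<in> W" "v \<noteq> 0" "T v = \<zeta> *s v"
proof -
  define p :: "complex poly" where "p = Polynomial.monom 1 N - 1"
  have c: "Polynomial.coeff p N = 1" using N by (simp add: p_def)
  have "(\<Sum>i\<le>N. Polynomial.coeff p i *s (T ^^ i) w)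
      = (\<Sum>i\<le>N. (if i = N then w else 0)) - (\<Sum>i\<le>N. (if i = 0 then w else 0))"
    unfolding sum_subtractf[symmetric] using N
    by (intro sum.cong) (auto simp: p_def Polynomial.coeff_1)
  then have "(\<Sum>i\<le>N. Polynomial.coeff p i *s (T ^^ i) w) = 0" by simp
  moreover have "Polynomial.degree p \<le> N"
    unfolding p_def by (intro degree_diff_le Polynomial.degree_monom_le) auto
  moreover have "p \<noteq> 0" using c by auto
  ultimately show ?thesis using eigenvector_from_annihilator[OF T W w, of p N] that by blast
qed

lemma eigenvectors_linear_independent:
  fixes T :: "complex^'n::finite \<Rightarrow> complex^'n"
  assumes T: "clinear T" and "finite I" and "inj_on \<mu> I" and "\<And>i. i \<in> I \<Longrightarrow> u i \<noteq> 0"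
    and "\<And>i. i \<in> I \<Longrightarrow> T (u i) = \<mu> i *s u i" and "(\<Sum>i\<in>I. a i *s u i) = 0" and "i \<in> I"
  shows "a i = 0"
  using assms(2-)
proof (induction I arbitrary: a i rule: finite_induct)
  case (insert j I)
  \<comment> \<open>Applying T - \<mu>_j removes the \<open>j\<close>-th term and multiplies the
    others by the nonzero numbers \<mu>_i - \<mu>_j.\<close>
  have "0 = T (\<Sum>i\<in>insert j I. a i *s u i) - \<mu> j *s (\<Sum>i\<in>insert j I. a i *s u i)"
    unfolding insert.prems(4) by (simp add: clinear_rules[OF T])
  also have "\<dots> = (\<Sum>i\<in>insert j I. (a i * (\<mu> i - \<mu> j)) *s u i)"
    using insert.prems(3) unfolding clinear_rules(5)[OF T] vec.scale_sum_right sum_subtractf[symmetric]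
    by (intro sum.cong refl) (auto simp: clinear_rules[OF T] algebra_simps vec.scale_left_diff_distrib)
  also have "\<dots> = (\<Sum>i\<in>I. (a i * (\<mu> i - \<mu> j)) *s u i)" using insert.hyps by simp
  finally have *: "(\<Sum>i\<in>I. (a i * (\<mu> i - \<mu> j)) *s u i) = 0" by simp
  have "a k = 0" if "k \<in> I" for k
  proof -
    have "a k * (\<mu> k - \<mu> j) = 0"
      using insert.prems by (intro insert.IH[OF _ _ _ * that]) auto
    moreover have "\<mu> k \<noteq> \<mu> j"
      using insert.prems(1) insert.hyps(2) that by (metis inj_onD insert_iff)
    ultimately show ?thesis by simp
  qed
  moreover from this have "a j *s u j = 0" using insert.prems(4) insert.hyps by simp
  then have "a j = 0" using insert.prems(2)[of j] by simp
  ultimately show ?case using insert.prems(5) by auto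
qed auto

lemma eigenvectors_span_UNIV:
  fixes T :: "complex^'n::finite \<Rightarrow> complex^'n"
  assumes T: "clinear T" and inj: "inj_on \<mu> {..<CARD('n)}" and u: "\<And>i. i < CARD('n) \<Longrightarrow> u i \<noteq> 0"
    and Tu: "\<And>i. i < CARD('n) \<Longrightarrow> T (u i) = \<mu> i *s u i"
    and W: "vec.subspace W" "\<And>i. i < CARD('n) \<Longrightarrow> u i \<in> W"
  shows "W = UNIV"
proof -
  let ?I = "{..<CARD('n)}"
  have iu: "inj_on u ?I"
  proof (rule inj_onI)
    fix i j assume ij: "i \<in> ?I" "j \<in> ?I" "u i = u j"
    then have "\<mu> i *s u i = \<mu> j *s u i" using Tu[of i] Tu[of j] by (metis lessThan_iff)
    moreover have "u i \<noteq> 0" using u ij(1) by simp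
    ultimately have "\<mu> i = \<mu> j" by simp
    then show "i = j" using inj ij by (auto dest: inj_onD)
  qed
  have "vec.independent (u ` ?I)"
    unfolding vec.independent_explicit
  proof (intro conjI allI impI ballI)
    fix a v assume a: "(\<Sum>v\<in>u ` ?I. a v *s v) = 0" "v \<in> u ` ?I"
    have "(\<Sum>i\<in>?I. a (u i) *s u i) = 0" using a(1) by (simp add: sum.reindex[OF iu])
    then show "a v = 0"
      using eigenvectors_linear_independent[OF T finite_lessThan inj, of u "\<lambda>i. a (u i)"] a(2) u Tu by auto
  qed auto
  moreover have "card (u ` ?I) = CARD('n)" by (simp add: card_image[OF iu])
  ultimately have "vec.span (u ` ?I) = UNIV"
    using vec.card_ge_dim_independent[of "u ` ?I" UNIV] by (simp add: card_cart_basis top.extremum_unique)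
  moreover have "vec.span (u ` ?I) \<subseteq> W" using W by (intro vec.span_minimal) auto
  ultimately show ?thesis by auto
qed

subsection \<open>The group of idempotents\<close>

locale finite_medial_algebra =
  fixes m :: "complex^'n::finite \<Rightarrow> complex^'n \<Rightarrow> complex^'n"  (infixl "\<star>" 70)
  assumes add_right: "x \<star> (y + z) = x \<star> y + x \<star> z"
    and scale_right: "x \<star> (a *s y) = a *s (x \<star> y)"
    and comm: "x \<star> y = y \<star> x"
    and mediality: "(x \<star> y) \<star> (z \<star> w) = (x \<star> z) \<star> (y \<star> w)"
    and finite_idempotents: "finite {x. x \<star> x = x}"
    and no_orthogonal: "x \<star> x = x \<Longrightarrow> y \<star> y = y \<Longrightarrow> x \<star> y = 0 \<Longrightarrow> x = 0 \<or> y = 0"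
begin

definition idem :: "(complex^'n) set" where "idem = {x. x \<noteq> 0 \<and> x \<star> x = x}"

lemma finite_idem: "finite idem"
  by (rule finite_subset[OF _ finite_idempotents]) (auto simp: idem_def)

lemma linear_left: "clinear ((\<star>) x)"
  by (intro clinearI add_right scale_right)

text \<open>Mediality gives (xy)(xy) = (xx)(yy), and \<open>no_orthogonal\<close> excludes xy =
  0.\<close>

lemma idem_closed: "x \<in> idem \<Longrightarrow> y \<in> idem \<Longrightarrow> x \<star> y \<in> idem"
  using no_orthogonal[of x y] mediality[of x y x y] by (auto simp: idem_def)

lemma idem_funpow: "c \<in> idem \<Longrightarrow> x \<in> idem \<Longrightarrow> ((\<star>) c ^^ k) x \<in> idem"
  by (induction k) (auto intro: idem_closed)

text \<open>Iterates (ca)(db) = (cd)(ab). For \<open>c = d\<close> idempotent this makes every power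
  of L_c multiplicative.\<close>

lemma funpow_medial: "((\<star>) c ^^ k) a \<star> ((\<star>) d ^^ k) b = ((\<star>) (c \<star> d) ^^ k) (a \<star> b)"
proof (induction k)
  case (Suc k)
  then show ?case by (simp add: mediality[of c _ d])
qed simp

lemma funpow_hom: "c \<in> idem \<Longrightarrow> ((\<star>) c ^^ k) (a \<star> b) = ((\<star>) c ^^ k) a \<star> ((\<star>) c ^^ k) b"
  using funpow_medial[of k c a c b] by (simp add: idem_def)

text \<open>The difference \<open>x - o'\<close> has product \<open>x - o'\<close> with
  \<open>x\<close> and 0 with \<open>o'\<close>; it is therefore an idempotent orthogonal to
  \<open>o'\<close>.\<close>

lemma absorb:
  assumes "o' \<in> idem" "x \<in> idem" "o' \<star> x = o'"
  shows "x = o'"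
proof -
  have xo: "x \<star> o' = o'" using assms(3) comm by metis
  have "(x - o') \<star> x = x - o'"
    using assms xo comm[of "x - o'" x] by (simp add: clinear_rules[OF linear_left] idem_def)
  moreover have 0: "o' \<star> (x - o') = 0" using assms by (simp add: clinear_rules[OF linear_left] idem_def)
  then have "(x - o') \<star> o' = 0" using comm by metis
  ultimately have "(x - o') \<star> (x - o') = x - o'" by (simp add: clinear_rules(2)[OF linear_left])
  then show ?thesis using no_orthogonal[of o' "x - o'"] assms 0 by (auto simp: idem_def)
qed

lemma absorb_funpow: "o' \<in> idem \<Longrightarrow> x \<in> idem \<Longrightarrow> ((\<star>) o' ^^ k) x = o' \<Longrightarrow> x = o'"
proof (induction k)
  case (Suc k)
  then show ?case using absorb[of o' "((\<star>) o' ^^ k) x"] idem_funpow by auto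
qed simp

text \<open>Rules out preperiodic behaviour of L_c. Two readings of L_{cy}^k (xy) through
  \<open>funpow_medial\<close> give y = y (L_y^k x), that is, a power of L_y sends \<open>x\<close>
  to \<open>y\<close>, and absorption applies.\<close>

lemma funpow_stable:
  assumes "c \<in> idem" "x \<in> idem" and x: "((\<star>) c ^^ k) x = y" and y: "((\<star>) c ^^ k) y = y"
  shows "x = y"
proof -
  have yi: "y \<in> idem" using assms idem_funpow by blast
  then have yy: "y \<star> y = y" by (simp add: idem_def)
  have "((\<star>) y ^^ i) y = y" for i by (induction i) (auto simp: yy)
  then have "y = ((\<star>) (c \<star> y) ^^ k) (x \<star> y)" using funpow_medial[of k c x y y] x yy by simp
  also have "\<dots> = y \<star> ((\<star>) y ^^ k) x" using funpow_medial[of k c y y x] y comm[of x y] by simp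
  also have "\<dots> = ((\<star>) y ^^ Suc k) x" by simp
  finally show ?thesis using absorb_funpow[OF yi assms(2)] by metis
qed

text \<open>By finiteness two powers of L_c agree on \<open>idem\<close>, so some power L_c^s is a
  projection there; \<open>funpow_stable\<close> turns this projection into the identity.\<close>

lemma periodic:
  assumes c: "c \<in> idem"
  obtains s where "s > 0" "\<And>x. x \<in> idem \<Longrightarrow> ((\<star>) c ^^ s) x = x"
proof -
  define f where "f k = restrict ((\<star>) c ^^ k) idem" for k
  have "range f \<subseteq> idem \<rightarrow>\<^sub>E idem" using idem_funpow[OF c] by (auto simp: f_def)
  then have "finite (range f)" by (rule finite_subset) (intro finite_PiE finite_idem)
  then have "\<not> inj f" using finite_imageD infinite_UNIV_nat by blast
  then obtain i' j' where "f i' = f j'" "i' \<noteq> j'" unfolding inj_def by blast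
  then obtain i j where fij: "f i = f j" and "i < j" by (metis linorder_neqE_nat)
  then have ij: "((\<star>) c ^^ i) x = ((\<star>) c ^^ j) x" if "x \<in> idem" for x
  proof -
    have "f i x = f j x" using fij by simp
    with that show ?thesis by (simp add: f_def)
  qed
  define p where "p = j - i"
  have p: "p > 0" "j = p + i" using \<open>i < j\<close> by (auto simp: p_def)
  have step: "((\<star>) c ^^ (p + (i + l))) x = ((\<star>) c ^^ (i + l)) x" if "x \<in> idem" for x l
  proof -
    have "((\<star>) c ^^ (l + (p + i))) x = ((\<star>) c ^^ (l + i)) x"
      unfolding funpow_add comp_def using ij[OF that] p by (simp add: funpow_add)
    then show ?thesis by (simp add: ac_simps)
  qed
  have steps: "((\<star>) c ^^ (p * q + (i + l))) x = ((\<star>) c ^^ (i + l)) x" if "x \<in> idem" for x l q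
  proof (induction q)
    case (Suc q)
    have "((\<star>) c ^^ (p * Suc q + (i + l))) x = ((\<star>) c ^^ (p + (i + (p * q + l)))) x" by (simp add: algebra_simps)
    also have "\<dots> = ((\<star>) c ^^ (p * q + (i + l))) x" unfolding step[OF that] by (simp add: ac_simps)
    finally show ?case using Suc by simp
  qed simp
  \<comment> \<open>A multiple of the period \<open>p\<close> that is at least the preperiod
    \<open>i\<close>, so that the powers 2s and s agree.\<close>
  define s where "s = p * Suc i"
  have "s > 0" using p by (simp add: s_def)
  moreover have "((\<star>) c ^^ s) x = x" if "x \<in> idem" for x
  proof -
    have "s \<ge> i" using p by (cases p) (auto simp: s_def)
    have "((\<star>) c ^^ (s + s)) x = ((\<star>) c ^^ s) x"
      using steps[OF that, of "Suc i" "s - i"]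
      by (simp only: s_def[symmetric] le_add_diff_inverse[OF \<open>s \<ge> i\<close>])
    then have "((\<star>) c ^^ s) (((\<star>) c ^^ s) x) = ((\<star>) c ^^ s) x" by (simp add: funpow_add)
    then show ?thesis by (rule funpow_stable[OF c that refl, symmetric])
  qed
  ultimately show ?thesis using that by blast
qed

end

section \<open>The group law and its linear representation\<close>

locale pointed_medial_algebra = finite_medial_algebra m
  for m :: "complex^'n::finite \<Rightarrow> complex^'n \<Rightarrow> complex^'n"  (infixl "\<star>" 70) +
  fixes c :: "complex^'n" and s :: nat
  assumes c_idem: "c \<in> idem" and s_pos: "s > 0"
    and c_periodic: "x \<in> idem \<Longrightarrow> ((\<star>) c ^^ s) x = x"
begin

text \<open>The inverse of L_c on \<open>idem\<close>, taken as a power of L_c: this makes it linear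
  and multiplicative on the whole algebra, before L_c is known to be invertible there.\<close>

definition \<psi> :: "complex^'n \<Rightarrow> complex^'n" where "\<psi> = (\<star>) c ^^ (s - 1)"

definition idem_group :: "(complex^'n) monoid" where
  "idem_group = \<lparr>carrier = idem, monoid.mult = \<lambda>x y. \<psi> (x \<star> y), one = c\<rparr>"

lemma \<psi>_right: "c \<star> \<psi> x = ((\<star>) c ^^ s) x"
  unfolding \<psi>_def using s_pos by (cases s) auto

lemma \<psi>_left: "\<psi> (c \<star> x) = ((\<star>) c ^^ s) x"
  unfolding \<psi>_def using s_pos by (cases s) (auto simp: funpow_swap1)

lemma \<psi>_idem: "x \<in> idem \<Longrightarrow> \<psi> x \<in> idem"
  unfolding \<psi>_def by (rule idem_funpow[OF c_idem])

lemma \<psi>_inverse: "x \<in> idem \<Longrightarrow> c \<star> \<psi> x = x" "x \<in> idem \<Longrightarrow> \<psi> (c \<star> x) = x"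
  by (simp_all add: \<psi>_right \<psi>_left c_periodic)

lemma \<psi>_hom: "\<psi> (x \<star> y) = \<psi> x \<star> \<psi> y"
  unfolding \<psi>_def by (rule funpow_hom[OF c_idem])

lemma \<psi>_linear: "clinear \<psi>"
  unfolding \<psi>_def by (intro clinear_funpow linear_left)

lemma idem_group_simps [simp]:
  "carrier idem_group = idem" "x \<otimes>\<^bsub>idem_group\<^esub> y = \<psi> (x \<star> y)" "\<one>\<^bsub>idem_group\<^esub> = c"
  by (simp_all add: idem_group_def)

lemma comm_group_idem_group: "comm_group idem_group"
proof (rule comm_groupI; simp)
  show "c \<in> idem" by (rule c_idem)
  show "\<psi> (x \<star> y) \<in> idem" if "x \<in> idem" "y \<in> idem" for x y
    using that by (intro \<psi>_idem idem_closed)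
  show "\<psi> (x \<star> y) = \<psi> (y \<star> x)" for x y by (simp add: comm)
  show "\<psi> (c \<star> x) = x" if "x \<in> idem" for x using that by (rule \<psi>_inverse)
  show "\<psi> (\<psi> (x \<star> y) \<star> z) = \<psi> (x \<star> \<psi> (y \<star> z))" if "x \<in> idem" "y \<in> idem" "z \<in> idem" for x y z
  proof -
    \<comment> \<open>Writing \<open>z\<close> as \<open>\<psi> (c \<star> z)\<close> brings both
      factors under \<psi>, where mediality can exchange \<open>y\<close> and
      \<open>c\<close>.\<close>
    have "\<psi> (x \<star> y) \<star> z = \<psi> (x \<star> y) \<star> \<psi> (c \<star> z)" using that by (simp add: \<psi>_inverse)
    also have "\<dots> = \<psi> ((x \<star> c) \<star> (y \<star> z))" by (simp only: \<psi>_hom[symmetric] mediality[of x y c z])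
    also have "\<dots> = x \<star> \<psi> (y \<star> z)" unfolding \<psi>_hom[of "x \<star> c"] using that by (simp add: comm[of x c] \<psi>_inverse)
    finally show ?thesis by simp
  qed
  show "\<exists>y\<in>idem. \<psi> (y \<star> x) = c" if x: "x \<in> idem" for x
  proof -
    obtain r where r: "r > 0" "\<And>y. y \<in> idem \<Longrightarrow> ((\<star>) x ^^ r) y = y" using periodic[OF x] by blast
    \<comment> \<open>Since L_x has order dividing \<open>r\<close> on \<open>idem\<close>, this
      solves xy = cc, and \<psi> takes cc to the neutral element \<open>c\<close>.\<close>
    define y where "y = ((\<star>) x ^^ (r - 1)) (c \<star> c)"
    have "c \<star> c \<in> idem" using c_idem idem_closed by blast
    have "x \<star> y = ((\<star>) x ^^ r) (c \<star> c)" using r by (cases r) (auto simp: y_def)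
    then have "x \<star> y = c \<star> c" using r \<open>c \<star> c \<in> idem\<close> by simp
    moreover have "y \<in> idem" unfolding y_def by (intro idem_funpow x \<open>c \<star> c \<in> idem\<close>)
    ultimately show ?thesis using \<psi>_inverse(2)[OF c_idem] comm[of y x] by metis
  qed
qed

sublocale comm_group idem_group by (rule comm_group_idem_group)

definition V :: "(complex^'n) set" where "V = vec.span idem"

text \<open>Translation by \<open>g\<close> in the group, extended linearly; on \<open>V\<close>
  these maps form a representation of the group.\<close>

definition M :: "complex^'n \<Rightarrow> complex^'n \<Rightarrow> complex^'n" where "M g x = \<psi> (g \<star> x)"

lemma idem_subset_V: "idem \<subseteq> V"
  by (simp add: V_def vec.span_superset)

lemma V_subspace: "vec.subspace V"
  by (simp add: V_def)

lemma linear_M: "clinear (M g)"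
  unfolding M_def by (intro clinear_compose[OF \<psi>_linear] linear_left)

lemma eq_on_V: "clinear f \<Longrightarrow> clinear g \<Longrightarrow> x \<in> V \<Longrightarrow> (\<And>x. x \<in> idem \<Longrightarrow> f x = g x) \<Longrightarrow> f x = g x"
  unfolding V_def by (rule vec.linear_eq_on)

lemma maps_V:
  assumes f: "clinear f" and "\<And>x. x \<in> idem \<Longrightarrow> f x \<in> idem" and x: "x \<in> V"
  shows "f x \<in> V"
  using x unfolding V_def
proof (induction rule: vec.span_induct_alt)
  case (step a y z)
  have "f y \<in> vec.span idem" using step(1) assms(2) by (intro vec.span_base)
  with step(2) show ?case
    unfolding clinear_rules[OF f] by (intro vec.span_add vec.span_scale)
qed (simp add: clinear_rules[OF f] vec.span_zero)

lemma M_V: "g \<in> idem \<Longrightarrow> x \<in> V \<Longrightarrow> M g x \<in> V"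
  by (rule maps_V[OF linear_M]) (auto simp: M_def intro: \<psi>_idem idem_closed)

lemma c_periodic_V: "x \<in> V \<Longrightarrow> ((\<star>) c ^^ s) x = x"
  by (rule eq_on_V[OF clinear_funpow[OF linear_left] vec.linear_ident]) (auto simp: c_periodic)

lemma M_M: "g \<in> idem \<Longrightarrow> h \<in> idem \<Longrightarrow> x \<in> V \<Longrightarrow> M g (M h x) = M (\<psi> (g \<star> h)) x"
  by (rule eq_on_V[OF clinear_compose[OF linear_M linear_M] linear_M])
    (use m_assoc in \<open>auto simp: M_def\<close>)

lemma M_commute: "g \<in> idem \<Longrightarrow> h \<in> idem \<Longrightarrow> x \<in> V \<Longrightarrow> M g (M h x) = M h (M g x)"
  by (simp add: M_M comm[of g h])

lemma M_c: "x \<in> V \<Longrightarrow> M c x = x"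
  by (simp add: M_def \<psi>_left c_periodic_V)

lemma M_funpow:
  assumes g: "g \<in> idem" and x: "x \<in> V"
  shows "(M g ^^ k) x = M (g [^]\<^bsub>idem_group\<^esub> k) x"
proof (induction k)
  case 0
  then show ?case by (simp add: M_c x)
next
  case (Suc k)
  have "g [^]\<^bsub>idem_group\<^esub> k \<in> idem" using nat_pow_closed[of g k] g by simp
  with Suc show ?case using g x by (simp add: M_M comm)
qed

text \<open>The elements of the group are added one at a time. The joint eigenspace for the earlier
  ones is invariant under the next translation, which commutes with them and has finite
  order.\<close>

lemma common_eigenvector:
  obtains v \<kappa> where "v \<in> V" "v \<noteq> 0" "\<And>g. g \<in> idem \<Longrightarrow> M g v = \<kappa> g *s v"
proof -
  have "\<exists>v\<in>V. v \<noteq> 0 \<and> (\<forall>g\<in>T. \<exists>z. M g v = z *s v)" if "finite T" "T \<subseteq> idem" for T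
    using that
  proof (induction T rule: finite_induct)
    case empty
    then show ?case using c_idem idem_subset_V by (auto simp: idem_def)
  next
    case (insert h T)
    then obtain w z where w: "w \<in> V" "w \<noteq> 0" "\<And>g. g \<in> T \<Longrightarrow> M g w = z g *s w" by (metis insert_subset)
    define W where "W = {x \<in> V. \<forall>g\<in>T. M g x = z g *s x}"
    have W: "vec.subspace W"
      unfolding W_def vec.subspace_def using V_subspace
      by (auto simp: clinear_rules[OF linear_M] vec.subspace_def vec.scale_right_distrib mult.commute)
    have hW: "M h x \<in> W" if "x \<in> W" for x
      using that insert.prems by (auto simp: W_def M_V M_commute[of _ h] clinear_rules[OF linear_M])
    have "order idem_group > 0" using finite_idem c_idem by (auto simp: order_def card_gt_0_iff)
    moreover have "(M h ^^ order idem_group) w = w"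
      using insert.prems w M_funpow[of h w] pow_order_eq_1[of h] by (simp add: M_c)
    moreover have "w \<in> W" using w by (simp add: W_def)
    ultimately obtain \<zeta> v where "v \<in> W" "v \<noteq> 0" "M h v = \<zeta> *s v"
      using eigenvector_of_finite_order[OF linear_M W hW _ w(2)] by blast
    then show ?case by (auto simp: W_def)
  qed
  from this[OF finite_idem order_refl] that show ?thesis by metis
qed


section \<open>The character of a common eigenvector\<close>

context
  fixes v \<kappa>
  assumes v: "v \<in> V" "v \<noteq> 0" and eigen: "\<And>g. g \<in> idem \<Longrightarrow> M g v = \<kappa> g *s v"
begin

lemma character_one: "\<kappa> c = 1"
proof -
  have "\<kappa> c *s v = 1 *s v" using eigen[OF c_idem] M_c[OF v(1)] by simp
  then show ?thesis using v(2) vec.scale_cancel_right[of "\<kappa> c" v 1] by blast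
qed

lemma character_mult:
  assumes "g \<in> idem" "h \<in> idem"
  shows "\<kappa> (\<psi> (g \<star> h)) = \<kappa> g * \<kappa> h"
proof -
  have "\<kappa> (\<psi> (g \<star> h)) *s v = M g (M h v)"
    using M_M[OF assms v(1)] eigen[of "\<psi> (g \<star> h)"] assms \<psi>_idem idem_closed by metis
  also have "\<dots> = (\<kappa> g * \<kappa> h) *s v"
    using assms by (simp add: eigen clinear_rules[OF linear_M] mult.commute)
  finally show ?thesis using v(2) by simp
qed

text \<open>As \<open>g = g \<star> g\<close>, the element \<open>\<psi> g\<close> is the square of
  \<open>g\<close> in the group.\<close>

lemma character_square: "g \<in> idem \<Longrightarrow> \<kappa> (\<psi> g) = (\<kappa> g)\<^sup>2"
  using character_mult[of g g] by (simp add: idem_def power2_eq_square)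

lemma character_pow: "g \<in> idem \<Longrightarrow> \<kappa> (g [^]\<^bsub>idem_group\<^esub> (k::nat)) = \<kappa> g ^ k"
proof (induction k)
  case (Suc k)
  have "g [^]\<^bsub>idem_group\<^esub> k \<in> idem" using nat_pow_closed[of g k] Suc.prems by simp
  with Suc show ?case by (simp add: character_mult)
qed (simp add: character_one)

text \<open>The mean of the kernel of \<open>\<kappa>\<close> is an idempotent absorbing every element of the kernel.\<close>
lemma character_kernel:
  assumes h: "h \<in> idem" "\<kappa> h = 1"
  shows "h = c"
proof -
  define H where "H = {h \<in> idem. \<kappa> h = 1}"
  have finH: "finite H" using finite_idem by (simp add: H_def)
  have cH: "c \<in> H" using c_idem character_one by (simp add: H_def)
  \<comment> \<open>Squaring preserves the kernel; being injective on a finite set, \<psi> permutes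
    \<open>H\<close>, so L_c preserves \<open>H\<close> too and \<open>H\<close> is closed under the
    algebra product.\<close>
  have "\<psi> ` H \<subseteq> H" by (auto simp: H_def \<psi>_idem character_square)
  moreover have "inj_on \<psi> H"
    by (rule inj_on_inverseI[where g = "(\<star>) c"]) (auto simp: H_def \<psi>_inverse)
  ultimately have \<psi>H: "\<psi> ` H = H" using endo_inj_surj[OF finH] by blast
  have cxH: "c \<star> x \<in> H" if "x \<in> H" for x
  proof -
    have "x \<in> \<psi> ` H" using that \<psi>H by simp
    then obtain y where "y \<in> H" "x = \<psi> y" by (elim imageE)
    then show ?thesis by (auto simp: H_def \<psi>_inverse)
  qed
  have mH: "x \<star> y \<in> H" if "x \<in> H" "y \<in> H" for x y
  proof -
    have "\<psi> (x \<star> y) \<in> H" using that by (auto simp: H_def character_mult \<psi>_idem idem_closed)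
    then have "c \<star> \<psi> (x \<star> y) \<in> H" by (rule cxH)
    then show ?thesis using that by (simp add: H_def \<psi>_inverse idem_closed)
  qed
  have injH: "inj_on ((\<star>) x) H" if x: "x \<in> H" for x
  proof -
    obtain r where r: "r > 0" "\<And>y. y \<in> idem \<Longrightarrow> ((\<star>) x ^^ r) y = y"
      using periodic[of x] x by (auto simp: H_def)
    show ?thesis
    proof (rule inj_on_inverseI)
      fix y assume "y \<in> H"
      have "((\<star>) x ^^ (r - 1)) (x \<star> y) = ((\<star>) x ^^ Suc (r - 1)) y" by (simp add: funpow_swap1)
      also have "\<dots> = y" using r \<open>y \<in> H\<close> by (simp add: H_def)
      finally show "((\<star>) x ^^ (r - 1)) (x \<star> y) = y" .
    qed
  qed
  define e where "e = (\<Sum>x\<in>H. x)"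
  have xe: "x \<star> e = e" if x: "x \<in> H" for x
  proof -
    \<comment> \<open>Multiplication by \<open>x\<close> permutes \<open>H\<close> and hence fixes
      the sum of its elements.\<close>
    have "(\<star>) x ` H = H" using mH x by (intro endo_inj_surj finH injH) auto
    have "x \<star> e = (\<Sum>y\<in>H. x \<star> y)" by (simp add: e_def clinear_rules[OF linear_left])
    also have "\<dots> = (\<Sum>y\<in>(\<star>) x ` H. y)" by (simp add: sum.reindex[OF injH[OF x]])
    finally show ?thesis using \<open>(\<star>) x ` H = H\<close> by (simp add: e_def)
  qed
  define N where "N = complex_of_nat (card H)"
  have "N \<noteq> 0" using finH cH by (auto simp: N_def)
  have ex: "e \<star> x = e" if "x \<in> H" for x using xe[OF that] comm by metis
  have "e \<star> e = (\<Sum>x\<in>H. e \<star> x)" by (subst (2) e_def) (simp add: clinear_rules[OF linear_left])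
  also have "\<dots> = (\<Sum>x\<in>H. 1 *s e)" by (simp add: ex)
  also have "\<dots> = N *s e" unfolding vec.scale_sum_left[symmetric] by (simp add: N_def)
  finally have ee: "e \<star> e = N *s e" .
  define u where "u = inverse N *s e"
  have ur: "x \<star> u = u" if "x \<in> H" for x using that by (simp add: u_def scale_right xe)
  have "u \<star> u = inverse N *s (inverse N *s (e \<star> e))"
    unfolding u_def scale_right comm[of "_ *s e" e] by simp
  also have "\<dots> = u" using \<open>N \<noteq> 0\<close> by (simp add: ee u_def)
  finally have "u \<star> u = u" .
  moreover have "u \<noteq> 0"
  proof
    assume "u = 0"
    then have "e = 0" using \<open>N \<noteq> 0\<close> by (simp add: u_def)
    \<comment> \<open>Every element of \<open>H\<close> fixes \<open>v\<close>, so the sum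
      \<open>e\<close> acts on \<open>v\<close> as the nonzero scalar \<open>N\<close>.\<close>
    have "(\<Sum>x\<in>H. M x v) = M e v"
      unfolding M_def e_def comm[of _ v] by (simp add: clinear_rules[OF \<psi>_linear] clinear_rules[OF linear_left])
    also have "\<dots> = 0" using \<open>e = 0\<close> unfolding M_def comm[of _ v]
      by (simp add: clinear_rules[OF \<psi>_linear] clinear_rules[OF linear_left])
    also have "(\<Sum>x\<in>H. M x v) = (\<Sum>x\<in>H. 1 *s v)" by (intro sum.cong) (auto simp: H_def eigen)
    also have "\<dots> = N *s v" unfolding vec.scale_sum_left[symmetric] by (simp add: N_def)
    finally show False using \<open>N \<noteq> 0\<close> v by simp
  qed
  ultimately have "u \<in> idem" by (simp add: idem_def)
  have "x = u" if "x \<in> H" for x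
    using absorb[OF \<open>u \<in> idem\<close>, of x] ur[OF that] that comm[of u x] by (simp add: H_def)
  then show ?thesis using cH h unfolding H_def by blast
qed

lemma character_inj: "inj_on \<kappa> idem"
proof (rule inj_onI)
  fix x y assume xy: "x \<in> idem" "y \<in> idem" "\<kappa> x = \<kappa> y"
  define z where "z = inv\<^bsub>idem_group\<^esub> y"
  have z: "z \<in> idem" "\<psi> (y \<star> z) = c" using xy inv_closed[of y] r_inv[of y] by (simp_all add: z_def)
  have "\<kappa> (\<psi> (x \<star> z)) = \<kappa> (\<psi> (y \<star> z))" using xy z(1) by (simp only: character_mult)
  then have "\<kappa> (\<psi> (x \<star> z)) = 1" by (simp only: z(2) character_one)
  then have "\<psi> (x \<star> z) = c" using xy z by (intro character_kernel \<psi>_idem idem_closed)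
  then show "x = y" using z xy r_cancel[of x z y] by simp
qed

text \<open>M_g L_c = L_c M_{\<psi>(g)}, and passing from \<open>g\<close> to
  \<open>\<psi> g\<close> squares the character; so each application of L_c squares the
  eigenvalue.\<close>

lemma eigenvector_shift:
  assumes "g \<in> idem"
  shows "M g (((\<star>) c ^^ i) v) = (\<kappa> g ^ 2 ^ i) *s ((\<star>) c ^^ i) v"
  using assms
proof (induction i arbitrary: g)
  case (Suc i)
  have "M g (c \<star> x) = c \<star> M (\<psi> g) x" for x
  proof -
    have "M g (c \<star> x) = \<psi> ((c \<star> \<psi> g) \<star> (c \<star> x))" using Suc.prems by (simp add: M_def \<psi>_inverse)
    also have "(c \<star> \<psi> g) \<star> (c \<star> x) = c \<star> (\<psi> g \<star> x)"
      using mediality[of c "\<psi> g" c x] c_idem by (simp add: idem_def)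
    also have "\<psi> \<dots> = c \<star> \<psi> (\<psi> g \<star> x)" by (simp add: \<psi>_right \<psi>_left)
    finally show ?thesis by (simp add: M_def)
  qed
  then show ?case using Suc.IH[of "\<psi> g"] Suc.prems
    by (simp add: \<psi>_idem character_square scale_right power_mult)
qed (simp add: eigen)

text \<open>The injective character maps the group onto all \<open>N\<close>-th roots of unity by
  counting. The generator is the preimage of a primitive root, whose explicit value later separates
  eigenvalues.\<close>

lemma ex_generator:
  assumes card: "card idem = N"
  obtains g where "g \<in> idem" "\<kappa> g = cis (2 * pi / real N)" "idem = range (\<lambda>k::nat. g [^]\<^bsub>idem_group\<^esub> k)"
proof -
  have N: "N > 0" using card finite_idem c_idem by (auto simp: card_gt_0_iff)
  have "\<kappa> ` idem \<subseteq> {z. z ^ N = 1}"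
  proof clarify
    fix g assume g: "g \<in> idem"
    then have "g [^]\<^bsub>idem_group\<^esub> N = c" using pow_order_eq_1[of g] card by (simp add: order_def)
    then show "\<kappa> g ^ N = 1" using character_pow[OF g, of N] character_one by simp
  qed
  moreover have "card (\<kappa> ` idem) = card {z::complex. z ^ N = 1}"
    using N by (simp add: card_image character_inj card card_roots_unity_eq)
  ultimately have im: "\<kappa> ` idem = {z. z ^ N = 1}"
    using N by (intro card_subset_eq finite_roots_unity) auto
  have "cis (2 * pi / real N) ^ N = 1"
  proof -
    have "cis (2 * pi / real N) ^ N = cis (real N * (2 * pi / real N))" by (rule Complex.DeMoivre)
    also have "real N * (2 * pi / real N) = 2 * pi" using N by simp
    finally show ?thesis by simp
  qed
  then obtain g where g: "g \<in> idem" "\<kappa> g = cis (2 * pi / real N)" using im by (metis (mono_tags, lifting) imageE mem_Collect_eq)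
  have pow: "g [^]\<^bsub>idem_group\<^esub> (k::nat) \<in> idem" for k using nat_pow_closed[of g k] g by simp
  have "x \<in> range (\<lambda>k::nat. g [^]\<^bsub>idem_group\<^esub> k)" if x: "x \<in> idem" for x
  proof -
    have "\<kappa> x ^ N = 1" using im x by blast
    then have "\<kappa> x \<in> (\<lambda>k. cis (2 * pi * real k / real N)) ` {..<N}"
      unfolding bij_betw_imp_surj_on[OF Complex.bij_betw_roots_unity[OF N]] by simp
    then obtain k where "\<kappa> x = cis (2 * pi * real k / real N)" by (elim imageE)
    also have "2 * pi * real k / real N = real k * (2 * pi / real N)" by simp
    also have "cis \<dots> = \<kappa> (g [^]\<^bsub>idem_group\<^esub> k)"
      unfolding character_pow[OF g(1)] g(2) Complex.DeMoivre ..
    finally have "x = g [^]\<^bsub>idem_group\<^esub> k" by (rule inj_onD[OF character_inj _ x pow])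
    then show ?thesis by simp
  qed
  with pow have "idem = range (\<lambda>k::nat. g [^]\<^bsub>idem_group\<^esub> k)" by blast
  with g that show ?thesis by blast
qed

end

lemma cyclic_idem_group: "cyclic_group idem_group"
proof -
  obtain v \<kappa> where v: "v \<in> V" "v \<noteq> 0" "\<And>g. g \<in> idem \<Longrightarrow> M g v = \<kappa> g *s v"
    using common_eigenvector by blast
  obtain g where g: "g \<in> idem" "idem = range (\<lambda>k::nat. g [^]\<^bsub>idem_group\<^esub> k)"
    using ex_generator[OF v refl] by blast
  have "carrier idem_group = range (\<lambda>k::int. g [^]\<^bsub>idem_group\<^esub> k)"
  proof
    show "carrier idem_group \<subseteq> range (\<lambda>k::int. g [^]\<^bsub>idem_group\<^esub> k)"
    proof
      fix x assume "x \<in> carrier idem_group"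
      then have "x \<in> range (\<lambda>k::nat. g [^]\<^bsub>idem_group\<^esub> k)" using g(2) by simp
      then obtain k :: nat where "x = g [^]\<^bsub>idem_group\<^esub> k" by (elim imageE)
      then have "x = g [^]\<^bsub>idem_group\<^esub> int k" by (simp only: int_pow_int)
      then show "x \<in> range (\<lambda>k::int. g [^]\<^bsub>idem_group\<^esub> k)" by (rule range_eqI)
    qed
    show "range (\<lambda>k::int. g [^]\<^bsub>idem_group\<^esub> k) \<subseteq> carrier idem_group"
      using int_pow_closed[of g] g(1) by auto
  qed
  moreover have "g \<in> carrier idem_group" using g(1) by simp
  ultimately show ?thesis unfolding cyclic_group by blast
qed

text \<open>Shifting \<open>v\<close> by powers of L_c yields as many eigenvectors of one
  translation as the dimension, with distinct eigenvalues. They lie in \<open>V\<close>, so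
  \<open>V\<close> is everything and the period of L_c on \<open>V\<close> is global.\<close>

lemma funpow_c_eq_id:
  assumes card: "card idem = 2 ^ CARD('n) - 1"
  shows "((\<star>) c ^^ s) x = x"
proof -
  define N :: nat where "N = 2 ^ CARD('n) - 1"
  obtain v \<kappa> where v: "v \<in> V" "v \<noteq> 0" "\<And>g. g \<in> idem \<Longrightarrow> M g v = \<kappa> g *s v"
    using common_eigenvector by blast
  obtain g where g: "g \<in> idem" "\<kappa> g = cis (2 * pi / real N)"
    using ex_generator[OF v card] unfolding N_def by blast
  define u where "u i = ((\<star>) c ^^ i) v" for i
  have uV: "u i \<in> V" for i
    unfolding u_def
    by (rule maps_V[OF clinear_funpow[OF linear_left] _ v(1)]) (rule idem_funpow[OF c_idem])
  have "card idem > 0" using finite_idem c_idem by (auto simp: card_gt_0_iff)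
  then have N: "N > 0" by (simp only: card N_def)
  have "inj_on (\<lambda>i. \<kappa> g ^ 2 ^ i) {..<CARD('n)}"
  proof (rule inj_onI)
    fix i j assume ij: "i \<in> {..<CARD('n)}" "j \<in> {..<CARD('n)}" "\<kappa> g ^ 2 ^ i = \<kappa> g ^ 2 ^ j"
    show "i = j"
    \<comment> \<open>In dimension 1 the bound \<open>2 ^ i < N\<close> fails, as both sides are 1,
      but there is only one index.\<close>
    proof (cases "CARD('n) = 1")
      case False
      then have "CARD('n) > 1" using zero_less_card_finite[where 'a = 'n] by linarith
      define n where "n = CARD('n) - 2"
      have n: "CARD('n) = Suc (Suc n)" using \<open>CARD('n) > 1\<close> by (simp add: n_def)
      have lt: "2 ^ i < N" if "i \<in> {..<CARD('n)}" for i
      proof -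
        have "(2::nat) ^ i \<le> 2 ^ Suc n" using that n by (intro power_increasing) auto
        moreover have "(2::nat) ^ n \<ge> 1" by simp
        ultimately show ?thesis unfolding N_def n power_Suc by linarith
      qed
      have "\<kappa> g ^ k = cis (2 * pi * real k / real N)" for k
        unfolding g(2) Complex.DeMoivre by (rule arg_cong[of _ _ cis]) simp
      then have "cis (2 * pi * real (2 ^ i) / real N) = cis (2 * pi * real (2 ^ j) / real N)"
        using ij(3) by metis
      then have "(2::nat) ^ i = 2 ^ j"
        by (rule inj_onD[OF bij_betw_imp_inj_on[OF Complex.bij_betw_roots_unity[OF N]]])
          (use lt ij in auto)
      then show ?thesis by simp
    qed (use ij in auto)
  qed
  moreover have "u i \<noteq> 0" for i
  proof
    assume "u i = 0"
    \<comment> \<open>Further powers of L_c would stay 0, but the power \<open>s * i\<close> returns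
      \<open>v\<close>.\<close>
    then have "((\<star>) c ^^ (k + i)) v = 0" for k
      unfolding funpow_add u_def comp_def by (simp add: clinear_rules(4)[OF clinear_funpow[OF linear_left]])
    moreover have "i * (s - 1) + i = s * i" using s_pos by (cases s) auto
    ultimately have "((\<star>) c ^^ (s * i)) v = 0" by metis
    moreover have "((\<star>) c ^^ (s * i)) v = v" for i
      using c_periodic_V[OF v(1)] by (induction i) (auto simp: funpow_add)
    ultimately show False using v by simp
  qed
  ultimately have "V = UNIV"
    using eigenvectors_span_UNIV[OF linear_M[of g], of "\<lambda>i. \<kappa> g ^ 2 ^ i" u V] uV V_subspace
      eigenvector_shift[OF v g(1)] unfolding u_def by blast
  then show ?thesis using c_periodic_V by blast
qed

end

subsection \<open>Complexification and spectra\<close>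

lemma amul_linear_right: "clinear (amul gam x)"
  by (rule clinearI)
    (simp_all add: amul_def vec_eq_iff algebra_simps sum.distrib sum_distrib_left)

lemma amul_commute: "commutative_sc gam \<Longrightarrow> amul gam x y = amul gam y x"
  unfolding amul_def commutative_sc_def by (subst sum.swap) (simp add: mult.commute)

lemma amul_linear_left: "commutative_sc gam \<Longrightarrow> clinear (\<lambda>x. amul gam x y)"
  using amul_linear_right[of gam y] by (simp add: amul_commute[of gam _ y])

lemma clinear_eq_on_axes:
  assumes "clinear f" "clinear g" "\<And>i. f (axis i 1) = g (axis i 1)"
  shows "f x = g x"
proof (rule vec.linear_eq_on[OF assms(1,2)])
  show "x \<in> vec.span cart_basis" by (simp add: span_cart_basis)
qed (use assms(3) in \<open>auto simp: cart_basis_def\<close>)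

text \<open>Both sides are linear in each variable and agree on the standard basis, which lies in
  \<open>carrierK K\<close>; the variables are freed one after another.\<close>

lemma medial_complexification:
  assumes K: "is_subfield_C K" and comm: "commutative_sc gam" and med: "medial K gam"
  shows "amul gam (amul gam x y) (amul gam z w) = amul gam (amul gam x z) (amul gam y w)"
proof -
  note lin = amul_linear_right[of gam] amul_linear_left[OF comm]
  note comps = clinear_compose[OF lin(1)] clinear_compose[OF lin(2)] lin
  have ax: "axis i 1 \<in> carrierK K" for i
    using K by (auto simp: carrierK_def axis_def is_subfield_C_def)
  have 1: "amul gam (amul gam (axis i 1) (axis j 1)) (amul gam (axis k 1) (axis l 1))
      = amul gam (amul gam (axis i 1) (axis k 1)) (amul gam (axis j 1) (axis l 1))" for i j k l
    using med ax unfolding medial_def by blast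
  have 2: "amul gam (amul gam x (axis j 1)) (amul gam (axis k 1) (axis l 1))
      = amul gam (amul gam x (axis k 1)) (amul gam (axis j 1) (axis l 1))" for j k l
    by (rule clinear_eq_on_axes[of "\<lambda>x. amul gam (amul gam x _) _" "\<lambda>x. amul gam (amul gam x _) _"];
        (rule comps 1)+)
  have 3: "amul gam (amul gam x y) (amul gam (axis k 1) (axis l 1))
      = amul gam (amul gam x (axis k 1)) (amul gam y (axis l 1))" for k l
    by (rule clinear_eq_on_axes[of "\<lambda>y. amul gam (amul gam x y) _" "\<lambda>y. amul gam _ (amul gam y _)"];
        (rule comps 2)+)
  have 4: "amul gam (amul gam x y) (amul gam z (axis l 1))
      = amul gam (amul gam x z) (amul gam y (axis l 1))" for l
    by (rule clinear_eq_on_axes[of "\<lambda>z. amul gam _ (amul gam z _)" "\<lambda>z. amul gam (amul gam _ z) _"];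
        (rule comps 3)+)
  show ?thesis
    by (rule clinear_eq_on_axes[of "\<lambda>w. amul gam _ (amul gam _ w)" "\<lambda>w. amul gam _ (amul gam _ w)"];
        (rule comps 4)+)
qed

section \<open>Characteristic polynomials and orthogonal idempotents\<close>

lemma mat_mult_vec: "mat t *v x = t *s (x :: complex^'n::finite)"
  by (simp add: vec_eq_iff matrix_vector_mult_def mat_def if_distrib if_distribR cong: if_cong)

lemma Lmat_mult_vec: "Lmat gam c *v x = amul gam c x"
  unfolding vec_eq_iff Lmat_def amul_def matrix_vector_mult_def
  by (auto simp: sum_distrib_right sum_distrib_left mult_ac intro: trans[OF _ sum.swap])

lemma poly_det: "poly (det A) t = det (\<chi> i j. poly (A $ i $ j) t)"
  by (simp add: det_def poly_sum poly_prod)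

lemma poly_charpoly_L: "poly (charpoly_L gam c) t = det (mat t - Lmat gam c)"
  unfolding charpoly_L_def poly_det
  by (rule arg_cong[of _ _ det]) (simp add: vec_eq_iff mat_def)

text \<open>Reversing the polynomial: \<open>det (1 - s L)\<close> does not vanish at \<open>s = 0\<close>.\<close>
lemma charpoly_L_nonzero: "charpoly_L gam c \<noteq> 0"
proof
  assume 0: "charpoly_L gam c = 0"
  define q where "q = det (\<chi> k j. (if k = j then 1 else 0) - [:0, Lmat gam c $ k $ j:])"
  have q: "poly q s = det (mat 1 - (\<chi> k j. s * Lmat gam c $ k $ j))" for s
    unfolding q_def poly_det by (rule arg_cong[of _ _ det]) (simp add: vec_eq_iff mat_def)
  have "poly q 0 = 1" unfolding q by (subst det_I[symmetric]) (rule arg_cong[of _ _ det], simp add: vec_eq_iff)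
  then have "q \<noteq> 0" by auto
  then have "finite {s. poly q s = 0}" by (rule poly_roots_finite)
  moreover have "{s. poly q s = 0} \<union> {0} = UNIV"
  proof -
    have "poly q s = 0" if "s \<noteq> 0" for s
    proof -
      have L: "(\<chi> k j. s * Lmat gam c $ k $ j) *v x = s *s (Lmat gam c *v x)" for x
        by (simp add: vec_eq_iff matrix_vector_mult_def sum_distrib_left mult.assoc)
      \<comment> \<open>The factorization 1 - sL = s (1/s - L) expresses \<open>q\<close> at nonzero
        \<open>s\<close> through the characteristic polynomial at 1/s.\<close>
      have e: "mat 1 - (\<chi> k j. s * Lmat gam c $ k $ j) = mat s ** (mat (1 / s) - Lmat gam c)"
        unfolding matrix_eq using that
        by (simp add: matrix_vector_mul_assoc[symmetric] matrix_vector_mult_diff_rdistrib mat_mult_vec L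
            vec.scale_right_diff_distrib)
      show ?thesis
        unfolding q e det_mul poly_charpoly_L[symmetric] 0 by simp
    qed
    then show ?thesis by auto
  qed
  ultimately have "finite (UNIV :: complex set)" by (metis finite.emptyI finite.insertI finite_Un)
  then show False by (simp add: infinite_UNIV_char_0)
qed

text \<open>The vector \<open>c\<close> is fixed by L_c, so 1 - L_c is singular.\<close>

lemma charpoly_L_idempotent_root:
  assumes "amul gam c c = c" "c \<noteq> 0"
  shows "poly (charpoly_L gam c) 1 = 0"
proof (rule ccontr)
  assume "poly (charpoly_L gam c) 1 \<noteq> 0"
  then have "invertible (mat 1 - Lmat gam c)" by (simp add: poly_charpoly_L invertible_det_nz)
  then have "\<forall>x. (mat 1 - Lmat gam c) *v x = 0 \<longrightarrow> x = 0"
    using matrix_left_invertible_ker[of "mat 1 - Lmat gam c"] unfolding invertible_def by blast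
  moreover have "(mat 1 - Lmat gam c) *v c = 0"
    by (simp add: matrix_vector_mult_diff_rdistrib Lmat_mult_vec assms)
  ultimately show False using assms by blast
qed

text \<open>If \<open>cd = 0\<close> then \<open>L\<^sub>cL\<^sub>d = 0\<close>, so the characteristic polynomials satisfy
  \<open>t\<^sup>n \<chi>\<^sub>c\<^sub>+\<^sub>d = \<chi>\<^sub>c \<chi>\<^sub>d\<close>; by isospectrality the common multiplicity of the root 1 equals its double.\<close>
lemma isospectral_no_orthogonal:
  fixes gam :: "'n::finite \<Rightarrow> 'n \<Rightarrow> 'n \<Rightarrow> complex"
  assumes K: "is_subfield_C K" and comm: "commutative_sc gam" and med: "medial K gam"
    and iso: "isospectral K gam" and c: "c \<in> Idm K gam" and d: "d \<in> Idm K gam"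
  shows "amul gam c d \<noteq> 0"
proof
  assume cd: "amul gam c d = 0"
  let ?m = "amul gam"
  note lin = clinear_rules[OF amul_linear_right]
  have cc: "?m c c = c" "?m d d = d" "c \<noteq> 0" "d \<noteq> 0" using c d by (auto simp: Idm_def)
  have dc: "?m d c = 0" using cd amul_commute[OF comm, of d c] by simp
  have sum: "?m (c + d) (c + d) = c + d"
    using amul_commute[OF comm, of "c + d" c] amul_commute[OF comm, of "c + d" d]
    by (simp add: lin cc cd dc)
  have "c + d \<noteq> 0"
  proof
    assume "c + d = 0"
    then have "?m c (c + d) = 0" by (simp add: lin)
    then show False by (simp add: lin cc cd)
  qed
  moreover have "c + d \<in> carrierK K" using K c d by (auto simp: carrierK_def Idm_def is_subfield_C_def)
  ultimately have s: "c + d \<in> Idm K gam" using sum by (simp add: Idm_def)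
  have LL: "?m c (?m d x) = 0" for x
  proof -
    \<comment> \<open>Replacing \<open>c\<close> by cc allows mediality to produce the factor cd =
      0.\<close>
    have "?m c (?m d x) = ?m (?m c c) (?m d x)" by (simp add: cc)
    also have "\<dots> = ?m (?m c d) (?m c x)" by (rule medial_complexification[OF K comm med])
    also have "\<dots> = 0" by (simp add: cd amul_commute[OF comm, of 0] lin)
    finally show ?thesis .
  qed
  have "poly ([:0, 1:] ^ CARD('n) * charpoly_L gam (c + d)) t = poly (charpoly_L gam c * charpoly_L gam d) t" for t
  proof -
    have "?m (c + d) x = ?m c x + ?m d x" for x
      using clinear_rules(1)[OF amul_linear_left[OF comm]] .
    then have "mat t ** (mat t - Lmat gam (c + d)) = (mat t - Lmat gam c) ** (mat t - Lmat gam d)"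
      unfolding matrix_eq
      by (simp add: matrix_vector_mul_assoc[symmetric] matrix_vector_mult_diff_rdistrib mat_mult_vec
          Lmat_mult_vec lin LL vec.scale_right_diff_distrib vec.scale_right_distrib)
    moreover have "det (mat t :: complex^'n^'n) = t ^ CARD('n)"
      by (subst det_diagonal) (auto simp: mat_def)
    ultimately have "t ^ CARD('n) * det (mat t - Lmat gam (c + d)) = det (mat t - Lmat gam c) * det (mat t - Lmat gam d)"
      by (metis det_mul)
    then show ?thesis by (simp add: poly_charpoly_L)
  qed
  then have "[:0, 1:] ^ CARD('n) * charpoly_L gam (c + d) = charpoly_L gam c * charpoly_L gam d"
    using poly_eq_poly_eq_iff by blast
  then have "Polynomial.order 1 ([:0, 1:] ^ CARD('n) * charpoly_L gam (c + d))
      = Polynomial.order 1 (charpoly_L gam c * charpoly_L gam d)" by simp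
  \<comment> \<open>The power of t has no root at 1, so it does not affect the multiplicities
    compared.\<close>
  moreover have "Polynomial.order 1 ([:0, 1:] ^ CARD('n) :: complex poly) = 0"
    by (rule order_0I) simp
  ultimately have "Polynomial.order 1 (charpoly_L gam (c + d))
      = Polynomial.order 1 (charpoly_L gam c) + Polynomial.order 1 (charpoly_L gam d)"
    by (simp add: order_mult charpoly_L_nonzero)
  moreover have "Polynomial.order 1 (charpoly_L gam x) = count (spectrum_L gam x) 1" for x
    by (simp add: spectrum_L_def charpoly_L_nonzero)
  moreover have "spectrum_L gam (c + d) = spectrum_L gam c" "spectrum_L gam d = spectrum_L gam c"
    using iso c d s unfolding isospectral_def by blast+
  ultimately have "Polynomial.order 1 (charpoly_L gam c) = 0" by simp
  then show False
    using charpoly_L_idempotent_root[OF cc(1,3)] charpoly_L_nonzero[of gam c] by (simp add: order_root)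
qed

section \<open>Descent from the complexification to \<open>K\<close>\<close>

theorem theorem8p3:
  fixes K :: "complex set" and gam :: "'n::finite \<Rightarrow> 'n \<Rightarrow> 'n \<Rightarrow> complex"
    and c :: "complex^'n"
  assumes "is_subfield_C K" and "alg_closed_C K"
    and "\<forall>i j k. gam i j k \<in> K"
    and "commutative_sc gam"
    and "medial K gam" and "generic gam" and "isospectral K gam"
    and "c \<in> Idm K gam"
  shows "bij_betw (amul gam c) (carrierK K) (carrierK K)
    \<and> (\<exists>e. group (Idm_group K gam c e) \<and> cyclic_group (Idm_group K gam c e)
            \<and> order (Idm_group K gam c e) = 2 ^ CARD('n) - 1)"
proof -
  let ?m = "amul gam"
  have fin: "finite {x. ?m x x = x}" and card: "card {x. ?m x x = x} = 2 ^ CARD('n)"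
    using \<open>generic gam\<close> by (auto simp: generic_def)
  \<comment> \<open>Rationality identifies the idempotents over \<open>K\<close> with all complex
    ones, so isospectrality over \<open>K\<close> governs the complexification.\<close>
  have Idm: "Idm K gam = {x. x \<noteq> 0 \<and> ?m x x = x}"
    using finite_idempotents_rational[OF assms(1-3) fin] by (auto simp: Idm_def)
  interpret finite_medial_algebra ?m
  proof
    show "?m (?m x y) (?m z w) = ?m (?m x z) (?m y w)" for x y z w
      by (rule medial_complexification[OF assms(1,4,5)])
    show "x = 0 \<or> y = 0" if "?m x x = x" "?m y y = y" "?m x y = 0" for x y
      using isospectral_no_orthogonal[OF assms(1,4,5,7), of x y] that unfolding Idm by blast
    show "?m x y = ?m y x" for x y by (rule amul_commute[OF assms(4)])
  qed (auto simp: clinear_rules[OF amul_linear_right] fin)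
  have idem: "idem = Idm K gam" by (simp add: idem_def Idm)
  have c: "c \<in> idem" using assms(8) idem by simp
  obtain s where s: "s > 0" "\<And>x. x \<in> idem \<Longrightarrow> (?m c ^^ s) x = x" using periodic[OF c] by blast
  interpret pointed_medial_algebra ?m c s by unfold_locales (use c s in auto)
  \<comment> \<open>Genericity counts 0 as well, whence the subtraction of 1.\<close>
  have "{x. ?m x x = x} = insert 0 idem"
    by (auto simp: idem_def clinear_rules[OF amul_linear_right])
  then have card_idem: "card idem = 2 ^ CARD('n) - 1"
    using card finite_idem by (simp add: idem_def)
  note period = funpow_c_eq_id[OF card_idem]
  have cK: "c \<in> carrierK K" using assms(8) by (simp add: Idm_def)
  have amulK: "?m x y \<in> carrierK K" if "x \<in> carrierK K" "y \<in> carrierK K" for x y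
    using that assms(3) subfield_subring_C[OF assms(1)] unfolding carrierK_def amul_def
    by (auto simp: subring_C_def intro!: subring_C_sum)
  have \<psi>K: "\<psi> x \<in> carrierK K" if "x \<in> carrierK K" for x
  proof -
    have "(?m c ^^ k) x \<in> carrierK K" for k using that cK amulK by (induction k) auto
    then show ?thesis by (simp add: \<psi>_def)
  qed
  \<comment> \<open>The inverse is \<psi>, a power of L_c, which preserves \<open>carrierK K\<close>
    because \<open>c\<close> has coordinates in \<open>K\<close>.\<close>
  have bij: "bij_betw (?m c) (carrierK K) (carrierK K)"
    by (rule bij_betwI[where g = \<psi>]) (auto simp: \<psi>_left \<psi>_right period cK amulK \<psi>K)
  let ?G = "Idm_group K gam c c"
  have carrier: "carrier ?G = idem" by (simp add: Idm_group_def idem)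
  have mult: "x \<otimes>\<^bsub>?G\<^esub> y = x \<otimes>\<^bsub>idem_group\<^esub> y" if "x \<in> idem" "y \<in> idem" for x y
  proof -
    have xy: "?m x y \<in> carrierK K" using that idem by (intro amulK) (auto simp: Idm_def)
    have "inv_into (carrierK K) (?m c) (?m x y) = \<psi> (?m x y)"
      by (rule inv_into_f_eq) (use bij xy in \<open>auto simp: bij_betw_def \<psi>K \<psi>_right period\<close>)
    then show ?thesis by (simp add: Idm_group_def boxplus_def)
  qed
  have one: "\<one>\<^bsub>?G\<^esub> = c" by (simp add: Idm_group_def)
  have group: "group ?G"
  proof (rule groupI; unfold carrier one)
    show "c \<in> idem" by (rule c)
    show "x \<otimes>\<^bsub>?G\<^esub> y \<in> idem" if "x \<in> idem" "y \<in> idem" for x y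
      using that m_closed[of x y] by (simp add: mult)
    show "x \<otimes>\<^bsub>?G\<^esub> y \<otimes>\<^bsub>?G\<^esub> z = x \<otimes>\<^bsub>?G\<^esub> (y \<otimes>\<^bsub>?G\<^esub> z)" if "x \<in> idem" "y \<in> idem" "z \<in> idem" for x y z
      using that m_assoc[of x y z] m_closed[of x y] m_closed[of y z] by (simp add: mult)
    show "c \<otimes>\<^bsub>?G\<^esub> x = x" if "x \<in> idem" for x using that c l_one[of x] by (simp add: mult)
    show "\<exists>y\<in>idem. y \<otimes>\<^bsub>?G\<^esub> x = c" if "x \<in> idem" for x
      using that l_inv[of x] inv_closed[of x] by (auto simp: mult intro!: bexI[of _ "inv\<^bsub>idem_group\<^esub> x"])
  qed
  \<comment> \<open>Both groups have the same carrier and operations that agree on it, so cyclicity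
    transfers along the identity.\<close>
  have "id \<in> iso idem_group ?G"
    by (auto simp: iso_def hom_def carrier mult bij_betw_def intro: \<psi>_idem idem_closed)
  then have "idem_group \<cong> ?G" by (rule is_isoI)
  then have "cyclic_group ?G"
    using isomorphic_group_cyclicity[OF _ is_group group] cyclic_idem_group by blast
  moreover have "order ?G = 2 ^ CARD('n) - 1" by (simp add: order_def carrier card_idem)
  ultimately show ?thesis using bij group by blast
qed

end
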